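(* Let $n,k$ be integers with $2\leq k\leq n-5$, and let $G$ be a connected graph of order $n$ (so $n\geq k+5$) with minimum degree $\delta\geq k+1$. If $$HM(G)\geq2n^{4}-22n^{3}+(12k+102)n^{2}-(48k+210)n+4k^{3}+12k^{2}+64k+164,$$ then $G$ is $k$-leaf-connected unless $G$ is (isomorphic to) a member of $\{K_{5}\vee5K_{1},\ K_{4}\vee4K_{1}\}$.
   Context: All graphs are finite, simple and undirected; the order of $G$ is $|V(G)|$. $d_G(v)$ is the degree of the vertex $v$ in $G$, and $\delta=\delta(G)$ is the minimum degree. The hyper-Zagreb index is $HM(G)=\sum_{uv\in E(G)}\big(d_{G}(u)+d_{G}(v)\big)^{2}$. For $k\geq 2$, a graph $G$ with $|V(G)|\geq k+1$ is $k$-leaf-connected if for every subset $S\subseteq V(G)$ with $|S|=k$, $G$ has a spanning tree $T$ such that $S$ is precisely the set of leaves of $T$. For vertex-disjoint graphs $G$ and $H$, $G+H$ is their disjoint union, $tG$ is the disjoint union of $t$ copies of $G$, and the join $G\vee H$ is obtained from $G+H$ by adding all possible edges between $V(G)$ and $V(H)$. $K_n$ is the complete graph of order $n$. *)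

theory Defs
  imports Main
begin

text \<open>
  Simple undirected graphs: an edge is the two-element set of its end vertices, so loops and
  parallel edges cannot occur in a graph satisfying \<open>simple_graph\<close>.
\<close>

record 'a ugraph =
  verts :: "'a set"
  edges :: "'a set set"

definition simple_graph :: "'a ugraph \<Rightarrow> bool" where
  "simple_graph G \<longleftrightarrow> finite (verts G) \<and> (\<forall>e \<in> edges G. e \<subseteq> verts G \<and> card e = 2)"

definition graph_order :: "'a ugraph \<Rightarrow> nat" where
  "graph_order G = card (verts G)"

definition graph_degree :: "'a ugraph \<Rightarrow> 'a \<Rightarrow> nat" where
  "graph_degree G v = card {e \<in> edges G. v \<in> e}"

definition min_degree :: "'a ugraph \<Rightarrow> nat" where
  "min_degree G = Min (graph_degree G ` verts G)"

text \<open>For an edge \<open>e = {u, v}\<close> (with \<open>u \<noteq> v\<close>) the inner sum is \<open>graph_degree G u + graph_degree G v\<close>.\<close>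

definition hyper_zagreb :: "'a ugraph \<Rightarrow> nat" where
  "hyper_zagreb G = (\<Sum>e \<in> edges G. (\<Sum>v \<in> e. graph_degree G v) ^ 2)"

definition adj_rel :: "'a ugraph \<Rightarrow> 'a rel" where
  "adj_rel G = {(u, v). {u, v} \<in> edges G}"

definition connected_graph :: "'a ugraph \<Rightarrow> bool" where
  "connected_graph G \<longleftrightarrow>
     verts G \<noteq> {} \<and> (\<forall>u \<in> verts G. \<forall>v \<in> verts G. (u, v) \<in> (adj_rel G)\<^sup>*)"

text \<open>A cycle is given by the list of its vertices, the first one not being repeated at the end.\<close>

definition is_cycle :: "'a ugraph \<Rightarrow> 'a list \<Rightarrow> bool" where
  "is_cycle G c \<longleftrightarrow> 3 \<le> length c \<and> distinct c \<and>
     (\<forall>i < length c. {c ! i, c ! (Suc i mod length c)} \<in> edges G)"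

definition tree :: "'a ugraph \<Rightarrow> bool" where
  "tree T \<longleftrightarrow> simple_graph T \<and> connected_graph T \<and> (\<nexists>c. is_cycle T c)"

definition spanning_tree :: "'a ugraph \<Rightarrow> 'a ugraph \<Rightarrow> bool" where
  "spanning_tree T G \<longleftrightarrow> tree T \<and> verts T = verts G \<and> edges T \<subseteq> edges G"

definition leaves :: "'a ugraph \<Rightarrow> 'a set" where
  "leaves T = {v \<in> verts T. graph_degree T v = 1}"

definition k_leaf_connected :: "nat \<Rightarrow> 'a ugraph \<Rightarrow> bool" where
  "k_leaf_connected k G \<longleftrightarrow> 2 \<le> k \<and> k + 1 \<le> graph_order G \<and>
     (\<forall>S \<subseteq> verts G. card S = k \<longrightarrow> (\<exists>T. spanning_tree T G \<and> leaves T = S))"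

definition complete_graph :: "nat \<Rightarrow> nat ugraph" where
  "complete_graph n =
     \<lparr>verts = {..<n}, edges = {{u, v} | u v. u < n \<and> v < n \<and> u \<noteq> v}\<rparr>"

text \<open>The sum type and the product with an index set make the parts vertex-disjoint.\<close>

definition disjoint_union :: "'a ugraph \<Rightarrow> 'b ugraph \<Rightarrow> ('a + 'b) ugraph" where
  "disjoint_union G H =
     \<lparr>verts = verts G <+> verts H,
      edges = (`) Inl ` edges G \<union> (`) Inr ` edges H\<rparr>"

definition graph_join :: "'a ugraph \<Rightarrow> 'b ugraph \<Rightarrow> ('a + 'b) ugraph" where
  "graph_join G H =
     \<lparr>verts = verts (disjoint_union G H),
      edges = edges (disjoint_union G H) \<union>
        {{Inl u, Inr v} | u v. u \<in> verts G \<and> v \<in> verts H}\<rparr>"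

definition copies :: "nat \<Rightarrow> 'a ugraph \<Rightarrow> (nat \<times> 'a) ugraph" where
  "copies t G =
     \<lparr>verts = {..<t} \<times> verts G,
      edges = (\<Union>i<t. (`) (Pair i) ` edges G)\<rparr>"

definition graph_isomorphic :: "'a ugraph \<Rightarrow> 'b ugraph \<Rightarrow> bool" where
  "graph_isomorphic G H \<longleftrightarrow> (\<exists>f. bij_betw f (verts G) (verts H) \<and>
     (\<forall>u \<in> verts G. \<forall>v \<in> verts G. {u, v} \<in> edges G \<longleftrightarrow> {f u, f v} \<in> edges H))"

end

theory Submission
  imports Defs
begin

text \<open>
  Both sides of the argument are controlled by degrees. Since
  \<open>(d(u) + d(v))\<^sup>2 = 2 (d(u)\<^sup>2 + d(v)\<^sup>2) - (d(u) - d(v))\<^sup>2\<close>, summing over the edges bounds the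
  hyper-Zagreb index by twice the sum of the cubes of the degrees, and the error is large as soon
  as vertices of very different degrees are adjacent (\<open>hyper_zagreb_deficit\<close>).

  On the other side stands a closure argument. If \<open>u\<close> and \<open>v\<close> are non-adjacent with
  \<open>d(u) + d(v) \<ge> n + k - 1\<close>, then adding the edge \<open>uv\<close> does not change \<open>k\<close>-leaf-connectedness:
  a spanning tree through \<open>uv\<close> can be rerouted by exchanging two edges for two others without
  changing any degree (\<open>leaf_connected_on_closure\<close>). Hence a graph that is not \<open>k\<close>-leaf-connected
  lies in an edge-maximal one \<open>H\<close>, which is not complete and in which non-adjacent vertices have
  degree sum at most \<open>n + k - 2\<close>. As in Chvatal's theorem on Hamiltonian cycles, a non-adjacent
  pair of largest degree sum in \<open>H\<close> then forces many small degrees: with \<open>i = k + 1 + j\<close> the smaller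
  degree of the pair, there are \<open>i - k + 1\<close> vertices of degree at most \<open>i\<close> and a further
  \<open>n - 2 i + k - 1\<close> of degree at most \<open>n - i + k - 2\<close> (\<open>chvatal_partition\<close>). Adding edges only
  raises degrees, so these bounds hold in \<open>G\<close> too.

  Inserting the bounds into the cube sum gives a quantity \<open>capacity k j s\<close>, where
  \<open>n = k + 4 + 2 j + s\<close>. For \<open>j = 0\<close> it is exactly the threshold of the theorem, and for
  \<open>j \<ge> 1\<close> it is smaller than the threshold unless \<open>(j, s)\<close> is one of \<open>(1, 1)\<close>, \<open>(3, 0)\<close>, \<open>(1, 0)\<close>, \<open>(2, 0)\<close>.
  For \<open>j = 0\<close> and for the first two of these pairs, either some vertex allowed to have full degree
  \<open>n - 1\<close> fails to have it, which lowers the cube sum, or all of them are full and adjacent to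
  low-degree vertices, which makes the error term large; both contradict the hypothesis.
  In the last two cases a parity argument leaves only one possibility: all vertices allowed to have
  full degree have it (\<open>only_split_graphs\<close>). The graph is then the join of a clique
  \<open>K\<^bsub>k+1+j\<^esub>\<close> with \<open>j + 3\<close> isolated vertices. For \<open>k = 2\<close> this is one of the two exceptional graphs; for
  \<open>k \<ge> 3\<close> suitable spanning trees can be written down (\<open>leaf_connected_on_split_graph\<close>).
\<close>

section \<open>Trees by counting edges\<close>

text \<open>
  Graphs are handled as a vertex set \<open>V\<close> together with an edge set \<open>E\<close>, because edges are
  exchanged and added all the time while the vertices stay fixed.
\<close>

definition deg :: "'a set set \<Rightarrow> 'a \<Rightarrow> nat" where
  "deg E v = card {e \<in> E. v \<in> e}"

definition joined :: "'a set set \<Rightarrow> 'a \<Rightarrow> 'a \<Rightarrow> bool" where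
  "joined E x y \<longleftrightarrow> (x, y) \<in> {(a, b). {a, b} \<in> E}\<^sup>*"

definition simple_on :: "'a set \<Rightarrow> 'a set set \<Rightarrow> bool" where
  "simple_on V E \<longleftrightarrow> finite V \<and> (\<forall>e \<in> E. e \<subseteq> V \<and> card e = 2)"

text \<open>
  A tree is a connected graph with one edge less than vertices. Compared with acyclicity, this
  form survives edge exchanges: after an exchange only connectedness and a count need checking.
\<close>

definition tree_on :: "'a set \<Rightarrow> 'a set set \<Rightarrow> bool" where
  "tree_on V T \<longleftrightarrow> simple_on V T \<and> V \<noteq> {} \<and> (\<forall>x \<in> V. \<forall>y \<in> V. joined T x y) \<and>
     card T + 1 = card V"

lemma joined_refl [simp]: "joined E x x"
  by (simp add: joined_def)

lemma joined_sym: "joined E x y \<Longrightarrow> joined E y x"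
proof -
  have "sym {(a, b). {a, b} \<in> E}"
    by (auto simp: sym_def insert_commute)
  then show "joined E x y \<Longrightarrow> joined E y x"
    unfolding joined_def by (meson sym_rtrancl symD)
qed

lemma joined_trans [trans]: "joined E x y \<Longrightarrow> joined E y z \<Longrightarrow> joined E x z"
  unfolding joined_def by (rule rtrancl_trans)

lemma joined_edge: "{x, y} \<in> E \<Longrightarrow> joined E x y"
  unfolding joined_def by auto

lemma joined_substitute:
  assumes "joined E x y" and "\<And>a b. {a, b} \<in> E \<Longrightarrow> joined F a b"
  shows "joined F x y"
  using assms(1) unfolding joined_def
proof (induction rule: rtrancl_induct)
  case (step y z)
  then show ?case
    using assms(2)[of y z] by (auto simp: joined_def intro: rtrancl_trans)
qed simp

lemma joined_mono: "joined E x y \<Longrightarrow> E \<subseteq> F \<Longrightarrow> joined F x y"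
  by (erule joined_substitute) (auto intro: joined_edge)

lemma joined_induct [consumes 1, case_names base step]:
  assumes "joined E x y" and "P x"
    and "\<And>y z. joined E x y \<Longrightarrow> {y, z} \<in> E \<Longrightarrow> P y \<Longrightarrow> P z"
  shows "P y"
  using assms(1) unfolding joined_def
proof (induction rule: rtrancl_induct)
  case (step y z)
  then show ?case using assms(3)[of y z] by (auto simp: joined_def)
qed (rule assms(2))

lemma simple_onD:
  assumes "simple_on V E" and "{x, y} \<in> E"
  shows "x \<in> V" "y \<in> V" "x \<noteq> y"
  using assms by (fastforce simp: simple_on_def)+

lemma simple_on_finite: "simple_on V E \<Longrightarrow> finite E"
  unfolding simple_on_def by (meson Pow_iff finite_Pow_iff finite_subset subsetI)

lemma simple_on_edgeE:
  assumes "simple_on V E" and "e \<in> E"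
  obtains x y where "e = {x, y}" "x \<in> V" "y \<in> V" "x \<noteq> y"
  using assms unfolding simple_on_def by (metis card_2_iff insert_subset)

lemma simple_on_subset: "simple_on V E \<Longrightarrow> F \<subseteq> E \<Longrightarrow> simple_on V F"
  unfolding simple_on_def by blast

text \<open>
  Every vertex other than a root \<open>r\<close> is assigned an edge leading to a vertex closer to \<open>r\<close>.
  This is injective: the vertex is the end of its edge farther from \<open>r\<close>.
\<close>

lemma card_le_Suc_edges_if_linked:
  assumes "simple_on V E" and linked: "\<forall>x \<in> V. \<forall>y \<in> V. joined E x y"
  shows "card V \<le> card E + 1"
proof (cases "V = {}")
  case False
  then obtain r where r: "r \<in> V" by blast
  define R where "R = {(a, b). {a, b} \<in> E}"
  define dist where "dist y = (LEAST n. (r, y) \<in> R ^^ n)" for y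
  have reach: "(r, y) \<in> R ^^ dist y" if "y \<in> V" for y
  proof -
    have "(r, y) \<in> R\<^sup>*"
      using linked r that by (auto simp: joined_def R_def)
    then show ?thesis
      unfolding dist_def by (metis LeastI_ex rtrancl_imp_relpow)
  qed
  have "\<exists>x. {x, y} \<in> E \<and> dist x < dist y" if y: "y \<in> V - {r}" for y
  proof (cases "dist y")
    case 0
    then show ?thesis using reach[of y] y by auto
  next
    case (Suc m)
    then obtain x where x: "(r, x) \<in> R ^^ m" "(x, y) \<in> R"
      using reach[of y] y by auto
    then have "dist x \<le> m" unfolding dist_def by (simp add: Least_le)
    then show ?thesis using x Suc by (auto simp: R_def)
  qed
  then obtain p where p: "\<And>y. y \<in> V - {r} \<Longrightarrow> {p y, y} \<in> E \<and> dist (p y) < dist y"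
    by metis
  have "inj_on (\<lambda>y. {p y, y}) (V - {r})"
    using p by (auto intro!: inj_onI simp: doubleton_eq_iff) (metis Diff_iff less_asym singletonD)
  then have "card (V - {r}) \<le> card E"
    using p by (intro card_inj_on_le[where f = "\<lambda>y. {p y, y}"])
      (auto simp: simple_on_finite[OF assms(1)])
  then show ?thesis using r by simp
qed simp

text \<open>
  Otherwise the graph without the edge would still be connected, with too few edges.
\<close>

lemma tree_on_bridge:
  assumes T: "tree_on V T" and e: "{x, y} \<in> T"
  shows "\<not> joined (T - {{x, y}}) x y"
proof
  let ?F = "T - {{x, y}}"
  assume j: "joined ?F x y"
  have "joined ?F a b" if "{a, b} \<in> T" for a b
  proof (cases "{a, b} = {x, y}")
    case True
    then show ?thesis using j joined_sym by (metis doubleton_eq_iff)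
  next
    case False
    then show ?thesis using that by (intro joined_edge) auto
  qed
  then have "\<forall>a \<in> V. \<forall>b \<in> V. joined ?F a b"
    using T joined_substitute unfolding tree_on_def by metis
  moreover have S: "simple_on V ?F"
    using T simple_on_subset unfolding tree_on_def by blast
  ultimately have "card V \<le> card ?F + 1"
    using card_le_Suc_edges_if_linked by blast
  moreover have "card ?F < card T"
    using T e simple_on_finite unfolding tree_on_def by (metis card_Diff1_less)
  ultimately show False using T unfolding tree_on_def by linarith
qed

text \<open>
  The closing edge of a cycle is not a bridge, since the rest of the cycle joins its ends.
\<close>

lemma tree_on_no_cycle:
  assumes T: "tree_on V T"
  shows "\<not> is_cycle \<lparr>verts = V, edges = T\<rparr> c"
proof
  assume "is_cycle \<lparr>verts = V, edges = T\<rparr> c"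
  then have len: "3 \<le> length c" and d: "distinct c"
    and e: "\<And>i. i < length c \<Longrightarrow> {c ! i, c ! (Suc i mod length c)} \<in> T"
    by (auto simp: is_cycle_def)
  define m where "m = length c - 1"
  have m: "Suc m = length c" "2 \<le> m" using len by (auto simp: m_def)
  have close: "{c ! m, c ! 0} \<in> T" using e[of m] m by simp
  have "joined (T - {{c ! m, c ! 0}}) (c ! 0) (c ! i)" if "i \<le> m" for i
    using that
  proof (induction i)
    case (Suc i)
    have il: "i < length c" "Suc i < length c" "m < length c" "0 < length c"
      using Suc.prems m by linarith+
    have ne: "i \<noteq> m" using Suc.prems by linarith
    have "{c ! i, c ! Suc i} \<in> T" using e[OF il(1)] il(2) by simp
    moreover have "{c ! i, c ! Suc i} \<noteq> {c ! m, c ! 0}"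
    proof
      assume "{c ! i, c ! Suc i} = {c ! m, c ! 0}"
      then have "c ! i = c ! m \<or> c ! i = c ! 0 \<and> c ! Suc i = c ! m"
        by (metis doubleton_eq_iff)
      moreover have "c ! i \<noteq> c ! m"
        using nth_eq_iff_index_eq[OF d il(1,3)] ne by metis
      ultimately have *: "c ! i = c ! 0" "c ! Suc i = c ! m" by metis+
      have "i = 0" "Suc i = m"
        using nth_eq_iff_index_eq[OF d il(1,4)] nth_eq_iff_index_eq[OF d il(2,3)] * by metis+
      then show False using m by linarith
    qed
    ultimately have "joined (T - {{c ! m, c ! 0}}) (c ! i) (c ! Suc i)"
      by (intro joined_edge) auto
    moreover have "joined (T - {{c ! m, c ! 0}}) (c ! 0) (c ! i)"
      using Suc by simp
    ultimately show ?case by (blast intro: joined_trans)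
  qed simp
  from joined_sym[OF this[OF order_refl]] show False
    using tree_on_bridge[OF T close] by contradiction
qed

lemma tree_on_spanning_tree:
  assumes "tree_on (verts G) T" and "T \<subseteq> edges G"
  shows "spanning_tree \<lparr>verts = verts G, edges = T\<rparr> G"
proof -
  have "\<nexists>c. is_cycle \<lparr>verts = verts G, edges = T\<rparr> c"
    using tree_on_no_cycle[OF assms(1)] by blast
  then show ?thesis
    using assms unfolding spanning_tree_def tree_def simple_graph_def connected_graph_def
      adj_rel_def tree_on_def simple_on_def joined_def by simp
qed

text \<open>
  The part of \<open>k_leaf_connected\<close> that depends on the edges; it can only be gained, never lost,
  when edges are added.
\<close>

definition leaf_connected_on :: "nat \<Rightarrow> 'a set \<Rightarrow> 'a set set \<Rightarrow> bool" where
  "leaf_connected_on k V E \<longleftrightarrow>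
     (\<forall>S \<subseteq> V. card S = k \<longrightarrow> (\<exists>T \<subseteq> E. tree_on V T \<and> (\<forall>v \<in> V. deg T v = 1 \<longleftrightarrow> v \<in> S)))"

lemma k_leaf_connected_if_leaf_connected_on:
  assumes "leaf_connected_on k (verts G) (edges G)" and "2 \<le> k" and "k + 1 \<le> graph_order G"
  shows "k_leaf_connected k G"
  unfolding k_leaf_connected_def
proof (intro conjI allI impI)
  fix S assume S: "S \<subseteq> verts G" "card S = k"
  then obtain T where T: "T \<subseteq> edges G" "tree_on (verts G) T"
    "\<forall>v \<in> verts G. deg T v = 1 \<longleftrightarrow> v \<in> S"
    using assms(1) unfolding leaf_connected_on_def by blast
  have "leaves \<lparr>verts = verts G, edges = T\<rparr> = S"
    using T(3) S(1) by (auto simp: leaves_def graph_degree_def deg_def)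
  then show "\<exists>T. spanning_tree T G \<and> leaves T = S"
    using tree_on_spanning_tree[OF T(2,1)] by blast
qed (use assms in auto)

lemma deg_eq_card_neighbours:
  assumes "simple_on V E"
  shows "deg E v = card {w \<in> V. {v, w} \<in> E}"
proof -
  have "bij_betw (\<lambda>w. {v, w}) {w \<in> V. {v, w} \<in> E} {e \<in> E. v \<in> e}"
  proof (rule bij_betw_imageI)
    show "inj_on (\<lambda>w. {v, w}) {w \<in> V. {v, w} \<in> E}"
      by (auto intro!: inj_onI simp: doubleton_eq_iff)
    show "(\<lambda>w. {v, w}) ` {w \<in> V. {v, w} \<in> E} = {e \<in> E. v \<in> e}"
    proof (intro equalityI subsetI)
      fix e assume e: "e \<in> {e \<in> E. v \<in> e}"
      then obtain x y where "e = {x, y}" "x \<in> V" "y \<in> V" "x \<noteq> y"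
        using assms simple_on_edgeE by blast
      then show "e \<in> (\<lambda>w. {v, w}) ` {w \<in> V. {v, w} \<in> E}"
        using e by (auto simp: insert_commute)
    qed auto
  qed
  from bij_betw_same_card[OF this] show ?thesis
    by (simp add: deg_def)
qed

lemma deg_eq_sum: "finite E \<Longrightarrow> deg E v = (\<Sum>e \<in> E. of_bool (v \<in> e))"
  by (simp add: deg_def Int_def)

section \<open>The closure theorem\<close>

lemma joined_avoid:
  assumes "joined F u z" and "\<not> joined F u y"
  shows "joined {e \<in> F. y \<notin> e} u z"
  using assms(1)
proof (induction rule: joined_induct)
  case (step a b)
  have "joined F u b"
    using step(1) joined_edge[OF step(2)] by (rule joined_trans)
  then have "a \<noteq> y" "b \<noteq> y"
    using step(1) assms(2) by blast+
  then have "joined {e \<in> F. y \<notin> e} a b"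
    using step(2) by (intro joined_edge) auto
  with step.IH show ?case by (rule joined_trans)
qed simp

text \<open>
  \<open>p\<close> is the last vertex before \<open>x\<close> is reached for the first time. If there were no such \<open>p\<close>,
  the vertices reached without touching \<open>x\<close> would be closed under adjacency.
\<close>

lemma joined_last_edge:
  assumes "joined F u x" and "u \<noteq> x"
  obtains p where "{p, x} \<in> F" "joined {e \<in> F. x \<notin> e} u p"
proof -
  have "\<exists>p. {p, x} \<in> F \<and> joined {e \<in> F. x \<notin> e} u p"
  proof (rule ccontr)
    assume none: "\<nexists>p. {p, x} \<in> F \<and> joined {e \<in> F. x \<notin> e} u p"
    from assms(1) have "x \<noteq> x \<and> joined {e \<in> F. x \<notin> e} u x"
    proof (induction rule: joined_induct[where P = "\<lambda>z. z \<noteq> x \<and> joined {e \<in> F. x \<notin> e} u z"])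
      case base
      then show ?case using assms(2) by simp
    next
      case (step a b)
      then have "b \<noteq> x" using none by metis
      then have "joined {e \<in> F. x \<notin> e} a b"
        using step by (intro joined_edge) auto
      with step.IH have "joined {e \<in> F. x \<notin> e} u b" by (blast intro: joined_trans)
      then show ?case using \<open>b \<noteq> x\<close> by simp
    qed
    then show False by simp
  qed
  then show thesis using that by blast
qed

text \<open>
  Removing \<open>uv\<close> and \<open>xy\<close> splits the tree into three parts, one of which contains both \<open>u\<close> and \<open>x\<close>.
  The edges \<open>uy\<close> and \<open>vx\<close> reconnect them, and every one of the four ends loses one edge and
  gains one, so no degree changes. The two new edges are really new because
  the graph obtained is connected and so cannot have fewer edges than a tree.
\<close>

lemma tree_on_swap:
  assumes T: "tree_on V T" and uv: "{u, v} \<in> T" and xy: "{x, y} \<in> T" "{x, y} \<noteq> {u, v}"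
    and near: "joined (T - {{u, v}, {x, y}}) u x"
    and E: "simple_on V E" "{u, v} \<notin> E" "{u, y} \<in> E" "{v, x} \<in> E"
  shows "tree_on V (insert {u, y} (insert {v, x} (T - {{u, v}, {x, y}})))" (is "tree_on V ?T'")
    and "deg (insert {u, y} (insert {v, x} (T - {{u, v}, {x, y}}))) w = deg T w"
proof -
  let ?F = "T - {{u, v}, {x, y}}"
  have fin: "finite T" and S: "simple_on V T"
    using T simple_on_finite unfolding tree_on_def by blast+
  have cF: "card T = card ?F + 2"
  proof -
    have "card ?F = card T - card {{u, v}, {x, y}}"
      using uv xy by (intro card_Diff_subset) auto
    moreover have "card {{u, v}, {x, y}} = 2" using xy by simp
    moreover have "card {{u, v}, {x, y}} \<le> card T"
      using fin uv xy by (intro card_mono) auto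
    ultimately show ?thesis by linarith
  qed
  have S': "simple_on V ?T'"
    using S E unfolding simple_on_def by auto
  have ux: "joined ?T' u x" by (rule joined_mono[OF near]) blast
  have vx: "joined ?T' v x" and uy: "joined ?T' u y" by (auto intro: joined_edge)
  have uv': "joined ?T' u v" using joined_trans[OF ux joined_sym[OF vx]] .
  have xy': "joined ?T' x y" using joined_trans[OF joined_sym[OF ux] uy] .
  \<comment> \<open>every edge of the old tree can be replaced by a walk in the new one\<close>
  have edge: "joined ?T' a b" if ab: "{a, b} \<in> T" for a b
  proof -
    consider "{a, b} = {u, v}" | "{a, b} = {x, y}" | "{a, b} \<in> ?F" using ab by blast
    then show ?thesis
    proof cases
      case 1
      then show ?thesis using uv' joined_sym[OF uv'] by (auto simp: doubleton_eq_iff)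
    next
      case 2
      then show ?thesis using xy' joined_sym[OF xy'] by (auto simp: doubleton_eq_iff)
    next
      case 3
      then show ?thesis by (intro joined_edge) blast
    qed
  qed
  have linked: "\<forall>a \<in> V. \<forall>b \<in> V. joined ?T' a b"
  proof (intro ballI)
    fix a b assume "a \<in> V" "b \<in> V"
    then have "joined T a b" using T unfolding tree_on_def by blast
    then show "joined ?T' a b" by (rule joined_substitute) (rule edge)
  qed
  have finF: "finite ?F" using fin by simp
  have "card V \<le> card ?T' + 1" using card_le_Suc_edges_if_linked[OF S' linked] .
  then have low: "card ?F + 2 \<le> card ?T'"
    using cF T unfolding tree_on_def by linarith
  have a: "{v, x} \<notin> ?F"
  proof
    assume "{v, x} \<in> ?F"
    then have "?T' = insert {u, y} ?F" by blast
    then have "card ?T' \<le> card ?F + 1" using finF by (simp add: card_insert_if)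
    then show False using low by linarith
  qed
  have b: "{u, y} \<notin> insert {v, x} ?F"
  proof
    assume "{u, y} \<in> insert {v, x} ?F"
    then have "?T' = insert {v, x} ?F" by blast
    then have "card ?T' \<le> card ?F + 1" using finF by (simp add: card_insert_if)
    then show False using low by linarith
  qed
  have "card ?T' = card ?F + 2" using a b finF by simp
  then show "tree_on V ?T'"
    using S' linked T cF unfolding tree_on_def by simp
  have ne: "u \<noteq> v" "x \<noteq> y" "u \<noteq> y" "v \<noteq> x" "x \<noteq> u" "y \<noteq> v"
    using simple_onD(3)[OF S uv] simple_onD(3)[OF S xy(1)] simple_onD(3)[OF E(1,3)]
      simple_onD(3)[OF E(1,4)] E(2,3,4) by (auto simp: insert_commute)
  define i where "i e = (of_bool (w \<in> e) :: nat)" for e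
  have "T = insert {u, v} (insert {x, y} ?F)" using uv xy by blast
  then have "sum i T = sum i (insert {u, v} (insert {x, y} ?F))" by (rule arg_cong)
  also have "\<dots> = i {u, v} + sum i (insert {x, y} ?F)"
    using finF xy(2) by (intro sum.insert) auto
  also have "sum i (insert {x, y} ?F) = i {x, y} + sum i ?F"
    using finF by (intro sum.insert) auto
  also have "i {u, v} + (i {x, y} + sum i ?F) = i {u, y} + (i {v, x} + sum i ?F)"
    using ne by (auto simp: i_def)
  also have "\<dots> = sum i ?T'"
    using finF a b by simp
  finally show "deg ?T' w = deg T w"
    using deg_eq_sum[of ?T' w] deg_eq_sum[OF fin, of w] finF by (simp add: i_def)
qed

text \<open>
  The part of the closure argument on the side \<open>A\<close> of \<open>u\<close> in the tree minus \<open>uv\<close>, rooted at \<open>u\<close>.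
  Each neighbour of \<open>v\<close> in \<open>A\<close> that is not a leaf of the tree has a child, and if no exchange is
  possible then this child is not a neighbour of \<open>u\<close>. Different vertices have different children,
  so the neighbours of \<open>v\<close> that are not leaves are no more than the non-neighbours of \<open>u\<close>.
\<close>

lemma closure_one_side:
  assumes T: "tree_on V T" and uv: "{u, v} \<in> T"
    and E: "simple_on V E" "{u, v} \<notin> E" "T - {{u, v}} \<subseteq> E"
    and no_swap: "\<And>x y. {x, y} \<in> T \<Longrightarrow> {x, y} \<noteq> {u, v} \<Longrightarrow>
      joined (T - {{u, v}, {x, y}}) u x \<Longrightarrow> {u, y} \<in> E \<Longrightarrow> {v, x} \<notin> E"
  defines "A \<equiv> {w \<in> V. w \<noteq> u \<and> joined (T - {{u, v}}) u w}"
  shows "card {w \<in> A. {u, w} \<in> E} + card {w \<in> A. {v, w} \<in> E}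
    \<le> card A + card {w \<in> A. deg T w = 1}"
proof -
  let ?F = "T - {{u, v}}"
  have finT: "finite T" and S: "simple_on V T" and finV: "finite V"
    using T simple_on_finite unfolding tree_on_def simple_on_def by blast+
  have finA: "finite A" using finV by (simp add: A_def)
  have notv: "v \<notin> A" using tree_on_bridge[OF T uv] by (simp add: A_def)
  let ?P = "{w \<in> A. {v, w} \<in> E \<and> deg T w \<noteq> 1}"
  have child: "\<exists>c. {x, c} \<in> ?F \<and> joined (?F - {{x, c}}) u x" if x: "x \<in> ?P" for x
  proof -
    have xF: "joined ?F u x" "u \<noteq> x" "x \<noteq> v"
      using x notv by (auto simp: A_def)
    from xF(1,2) obtain p where p: "{p, x} \<in> ?F" "joined {e \<in> ?F. x \<notin> e} u p"
      by (rule joined_last_edge)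
    \<comment> \<open>\<open>x\<close> is not a leaf, so besides the edge to its parent \<open>p\<close> it has an edge to a child\<close>
    have "\<exists>f \<in> T. x \<in> f \<and> f \<noteq> {p, x}"
    proof (rule ccontr)
      assume "\<not> ?thesis"
      then have "{e \<in> T. x \<in> e} = {{p, x}}" using p(1) by blast
      then show False using x by (simp add: deg_def)
    qed
    then obtain f where f: "f \<in> T" "x \<in> f" "f \<noteq> {p, x}" by blast
    obtain a b where "f = {a, b}" using simple_on_edgeE[OF S f(1)] by blast
    then obtain c where c: "f = {x, c}" using f(2) by auto
    have xc: "{x, c} \<in> ?F" using f c xF by (auto simp: doubleton_eq_iff)
    have "joined (?F - {{x, c}}) u p"
      by (rule joined_mono[OF p(2)]) auto
    moreover have "joined (?F - {{x, c}}) p x"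
      using p(1) f(3) c by (intro joined_edge) auto
    ultimately have "joined (?F - {{x, c}}) u x" by (rule joined_trans)
    with xc show ?thesis by blast
  qed
  then have "\<forall>x \<in> ?P. \<exists>c. {x, c} \<in> ?F \<and> joined (?F - {{x, c}}) u x" by (rule ballI)
  from bchoice[OF this] obtain c
    where c: "\<And>x. x \<in> ?P \<Longrightarrow> {x, c x} \<in> ?F \<and> joined (?F - {{x, c x}}) u x"
    by (elim exE) (rule that, erule bspec)
  have far: "\<not> joined (?F - {{x, c x}}) u (c x)" if x: "x \<in> ?P" for x
  proof
    assume "joined (?F - {{x, c x}}) u (c x)"
    moreover have "joined (?F - {{x, c x}}) x u"
      using c[OF x] by (simp add: joined_sym)
    ultimately have "joined (?F - {{x, c x}}) x (c x)"
      by (rule joined_trans[rotated])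
    then have "joined (T - {{x, c x}}) x (c x)"
      by (rule joined_mono) blast
    then show False using tree_on_bridge[OF T] c[OF x] by blast
  qed
  have img: "c x \<in> {w \<in> A. {u, w} \<notin> E}" if x: "x \<in> ?P" for x
  proof -
    have e: "{x, c x} \<in> T" "{x, c x} \<noteq> {u, v}" using c[OF x] by auto
    have "joined ?F u x" using x by (simp add: A_def)
    moreover have "joined ?F x (c x)"
      using c[OF x] by (intro joined_edge) simp
    ultimately have "joined ?F u (c x)" by (rule joined_trans)
    moreover have "c x \<noteq> u" using far[OF x] by auto
    moreover have "c x \<in> V" using simple_onD(2)[OF S e(1)] .
    moreover have "{u, c x} \<notin> E"
    proof -
      have "T - {{u, v}, {x, c x}} = ?F - {{x, c x}}" by blast
      then have "joined (T - {{u, v}, {x, c x}}) u x" using c[OF x] by simp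
      then show ?thesis using no_swap[OF e] x by blast
    qed
    ultimately show ?thesis by (simp add: A_def)
  qed
  \<comment> \<open>a common child of two vertices would be joined to the root by two routes\<close>
  have "inj_on c ?P"
  proof (rule inj_onI, rule ccontr)
    fix x x' assume x: "x \<in> ?P" and x': "x' \<in> ?P" and eq: "c x = c x'" and ne: "x \<noteq> x'"
    have "joined {e \<in> ?F - {{x', c x}}. c x \<notin> e} u x'"
      using joined_avoid[of "?F - {{x', c x}}" u x' "c x"] c[OF x'] far[OF x'] eq by simp
    then have "joined (?F - {{x, c x}}) u x'"
      by (rule joined_mono) auto
    moreover have "joined (?F - {{x, c x}}) x' (c x)"
      using c[OF x'] eq ne by (intro joined_edge) (auto simp: doubleton_eq_iff)
    ultimately have "joined (?F - {{x, c x}}) u (c x)" by (rule joined_trans)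
    with far[OF x] show False by contradiction
  qed
  then have "card ?P \<le> card {w \<in> A. {u, w} \<notin> E}"
    using img finA by (intro card_inj_on_le[where f = c]) auto
  moreover have "card A = card {w \<in> A. {u, w} \<in> E} + card {w \<in> A. {u, w} \<notin> E}"
    using finA by (subst card_Un_disjoint[symmetric]) (auto intro: arg_cong[where f = card])
  moreover have "card {w \<in> A. {v, w} \<in> E} \<le> card (?P \<union> {w \<in> A. deg T w = 1})"
    using finA by (intro card_mono) auto
  moreover have "card (?P \<union> {w \<in> A. deg T w = 1}) \<le> card ?P + card {w \<in> A. deg T w = 1}"
    by (rule card_Un_le)
  ultimately show ?thesis by linarith
qed

text \<open>
  The two sides of the tree have \<open>n - 2\<close> vertices besides \<open>u\<close> and \<open>v\<close>, and the tree has \<open>k\<close> leaves,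
  so adding up the estimates for both sides gives \<open>d(u) + d(v) \<le> n - 2 + k\<close>.
\<close>

lemma leaf_connected_on_closure:
  assumes E: "simple_on V E" and uv: "u \<in> V" "v \<in> V" "u \<noteq> v" "{u, v} \<notin> E"
    and plus: "leaf_connected_on k V (insert {u, v} E)" and minus: "\<not> leaf_connected_on k V E"
  shows "deg E u + deg E v + 2 \<le> card V + k"
proof -
  obtain S where S: "S \<subseteq> V" "card S = k"
    and none: "\<And>T. T \<subseteq> E \<Longrightarrow> tree_on V T \<Longrightarrow> \<not> (\<forall>v \<in> V. deg T v = 1 \<longleftrightarrow> v \<in> S)"
    using minus unfolding leaf_connected_on_def by blast
  obtain T where T: "T \<subseteq> insert {u, v} E" "tree_on V T" and
    leaf: "\<forall>v \<in> V. deg T v = 1 \<longleftrightarrow> v \<in> S"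
    using plus S unfolding leaf_connected_on_def by blast
  have inT: "{u, v} \<in> T" using none[of T] T leaf by blast
  have TE: "T - {{u, v}} \<subseteq> E" using T(1) by blast
  have no_swap: "{b, x} \<notin> E" if "{a, b} = {u, v}" "{x, y} \<in> T" "{x, y} \<noteq> {a, b}"
    "joined (T - {{a, b}, {x, y}}) a x" "{a, y} \<in> E" for a b x y
  proof
    assume bx: "{b, x} \<in> E"
    have h: "{a, b} \<in> T" "{a, b} \<notin> E" using inT uv(4) that(1) by simp_all
    let ?T = "insert {a, y} (insert {b, x} (T - {{a, b}, {x, y}}))"
    note sw = tree_on_swap[OF T(2) h(1) that(2-4) E h(2) that(5) bx]
    have "?T \<subseteq> E" using that bx T(1) by auto
    then show False using none[OF _ sw(1)] leaf by (simp add: sw(2))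
  qed
  let ?F = "T - {{u, v}}"
  define A where "A = {w \<in> V. w \<noteq> u \<and> joined ?F u w}"
  define B where "B = {w \<in> V. w \<noteq> v \<and> joined ?F v w}"
  have finV: "finite V" using E by (simp add: simple_on_def)
  have fin: "finite A" "finite B" using finV by (auto simp: A_def B_def)
  have bridge: "\<not> joined ?F u v" using tree_on_bridge[OF T(2) inT] .
  have disj: "A \<inter> B = {}" "u \<notin> A" "v \<notin> A" "u \<notin> B" "v \<notin> B"
  proof -
    show "A \<inter> B = {}"
    proof (rule equals0I)
      fix w assume "w \<in> A \<inter> B"
      then have "joined ?F u w" "joined ?F w v" by (simp_all add: A_def B_def joined_sym)
      then have "joined ?F u v" by (rule joined_trans)
      with bridge show False by contradiction
    qed
    have "\<not> joined ?F v u" using bridge joined_sym[of ?F v u] by blast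
    then show "u \<notin> A" "v \<notin> A" "u \<notin> B" "v \<notin> B"
      using bridge by (simp_all add: A_def B_def)
  qed
  have cover: "w \<in> {u, v} \<union> A \<union> B" if w: "w \<in> V" for w
  proof -
    have "joined T u w" using T(2) uv(1) w unfolding tree_on_def by blast
    then have "joined ?F u w \<or> joined ?F v w"
    proof (induction rule: joined_induct)
      case (step a b)
      show ?case
      proof (cases "{a, b} = {u, v}")
        case True
        then have "b = u \<or> b = v" by (auto simp: doubleton_eq_iff)
        then show ?thesis by auto
      next
        case False
        then have "joined ?F a b" using step(2) by (intro joined_edge) auto
        then show ?thesis using step.IH joined_trans[of ?F _ a b] by blast
      qed
    qed simp
    then show ?thesis using w by (auto simp: A_def B_def)
  qed
  have V: "V = {u, v} \<union> (A \<union> B)"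
    using cover uv by (auto simp: A_def B_def)
  have "card V = card {u, v} + card (A \<union> B)"
    using fin disj by (subst V, intro card_Un_disjoint) auto
  then have cV: "card V = 2 + (card A + card B)"
    using uv(3) fin disj(1) by (simp add: card_Un_disjoint)
  have split: "deg E z = card {w \<in> A. {z, w} \<in> E} + card {w \<in> B. {z, w} \<in> E}"
    if z: "z = u \<or> z = v" for z
  proof -
    have "{z, u} \<notin> E" "{z, v} \<notin> E"
      using z uv(4) E by (auto simp: insert_commute simple_on_def)
    then have "{w \<in> V. {z, w} \<in> E} = {w \<in> A. {z, w} \<in> E} \<union> {w \<in> B. {z, w} \<in> E}"
      by (subst V) auto
    also have "card \<dots> = card {w \<in> A. {z, w} \<in> E} + card {w \<in> B. {z, w} \<in> E}"
      using fin disj(1) by (intro card_Un_disjoint) auto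
    finally show ?thesis by (simp add: deg_eq_card_neighbours[OF E])
  qed
  have vu: "{v, u} = {u, v}" by blast
  have sideA: "card {w \<in> A. {u, w} \<in> E} + card {w \<in> A. {v, w} \<in> E}
      \<le> card A + card {w \<in> A. deg T w = 1}"
    unfolding A_def by (rule closure_one_side[OF T(2) inT E uv(4) TE]) (rule no_swap, auto)
  have sideB: "card {w \<in> B. {v, w} \<in> E} + card {w \<in> B. {u, w} \<in> E}
      \<le> card B + card {w \<in> B. deg T w = 1}"
    unfolding B_def
    by (rule closure_one_side[of V T v u E, unfolded vu, OF T(2) inT E uv(4) TE])
      (rule no_swap[of v u, unfolded vu], auto)
  have "card {w \<in> A. deg T w = 1} + card {w \<in> B. deg T w = 1}
      = card ({w \<in> A. deg T w = 1} \<union> {w \<in> B. deg T w = 1})"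
    using fin disj(1) by (intro card_Un_disjoint[symmetric]) auto
  also have "\<dots> \<le> card S"
    using S(1) finV leaf by (intro card_mono) (auto simp: A_def B_def intro: finite_subset)
  finally show ?thesis
    using sideA sideB split[of u] split[of v] cV S(2) by simp
qed

section \<open>Constructing spanning trees with given leaves\<close>

lemma deg_insert:
  "finite T \<Longrightarrow> e \<notin> T \<Longrightarrow> deg (insert e T) x = of_bool (x \<in> e) + deg T x"
  by (simp add: deg_eq_sum del: sum_of_bool_eq)

lemma tree_on_attach:
  assumes "finite W" and "tree_on V T" and "W \<inter> V = {}" and "\<And>w. w \<in> W \<Longrightarrow> \<phi> w \<in> V"
  shows "tree_on (V \<union> W) (T \<union> (\<lambda>w. {w, \<phi> w}) ` W) \<and>
    (\<forall>w \<in> W. deg (T \<union> (\<lambda>w. {w, \<phi> w}) ` W) w = 1) \<and>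
    (\<forall>x \<in> V. deg (T \<union> (\<lambda>w. {w, \<phi> w}) ` W) x = deg T x + card {w \<in> W. \<phi> w = x})"
  using assms
proof (induction W)
  case empty
  then show ?case by simp
next
  case (insert a W)
  let ?T = "T \<union> (\<lambda>w. {w, \<phi> w}) ` W" and ?e = "{a, \<phi> a}"
  have IH: "tree_on (V \<union> W) ?T" "\<And>w. w \<in> W \<Longrightarrow> deg ?T w = 1"
    "\<And>x. x \<in> V \<Longrightarrow> deg ?T x = deg T x + card {w \<in> W. \<phi> w = x}"
    using insert by auto
  have aV: "a \<notin> V" "\<phi> a \<in> V" "a \<notin> W" using insert by auto
  have aW: "\<phi> a \<noteq> a" "\<phi> a \<notin> W" using aV insert.prems(2) by auto
  have S: "simple_on (V \<union> W) ?T" and c: "card ?T + 1 = card (V \<union> W)" and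
    link: "\<And>x y. x \<in> V \<union> W \<Longrightarrow> y \<in> V \<union> W \<Longrightarrow> joined ?T x y"
    using IH(1) unfolding tree_on_def by blast+
  have fin: "finite ?T" using simple_on_finite[OF S] .
  have ae: "a \<notin> e" if "e \<in> ?T" for e
    using S aV that unfolding simple_on_def by blast
  then have new: "?e \<notin> ?T" by blast
  have eq: "T \<union> (\<lambda>w. {w, \<phi> w}) ` insert a W = insert ?e ?T" by simp
  have "joined (insert ?e ?T) x (\<phi> a)" if "x \<in> V \<union> insert a W" for x
  proof (cases "x = a")
    case True
    then show ?thesis by (auto intro: joined_edge)
  next
    case False
    then have "joined ?T x (\<phi> a)" using link that aV by simp
    then show ?thesis by (rule joined_mono) blast
  qed
  then have "\<forall>x \<in> V \<union> insert a W. \<forall>y \<in> V \<union> insert a W. joined (insert ?e ?T) x y"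
    by (meson joined_trans joined_sym)
  moreover have "simple_on (V \<union> insert a W) (insert ?e ?T)"
  proof -
    have "card ?e = 2" using aW(1) by simp
    moreover have "?e \<subseteq> V \<union> insert a W" using aV(2) by blast
    moreover have "\<forall>e \<in> ?T. e \<subseteq> V \<union> insert a W \<and> card e = 2"
      using S unfolding simple_on_def by blast
    ultimately show ?thesis
      using S unfolding simple_on_def by (simp del: Un_insert_right)
  qed
  moreover have "card (insert ?e ?T) + 1 = card (V \<union> insert a W)"
    using c new fin aV S by (simp add: simple_on_def)
  ultimately have 1: "tree_on (V \<union> insert a W) (insert ?e ?T)"
    using IH(1) unfolding tree_on_def by blast
  have d: "deg (insert ?e ?T) x = of_bool (x \<in> ?e) + deg ?T x" for x
    by (rule deg_insert[OF fin new])
  have "{e \<in> ?T. a \<in> e} = {}" using ae by blast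
  then have "deg ?T a = 0" by (simp only: deg_def card.empty)
  then have 2: "\<forall>w \<in> insert a W. deg (insert ?e ?T) w = 1"
    using d IH(2) aV aW by auto
  have 3: "deg (insert ?e ?T) x = deg T x + card {w \<in> insert a W. \<phi> w = x}" if x: "x \<in> V" for x
  proof -
    have "{w \<in> insert a W. \<phi> w = x} =
        (if \<phi> a = x then insert a {w \<in> W. \<phi> w = x} else {w \<in> W. \<phi> w = x})" by auto
    then have "card {w \<in> insert a W. \<phi> w = x} = of_bool (\<phi> a = x) + card {w \<in> W. \<phi> w = x}"
      using aV insert.hyps(1) by simp
    moreover have "x \<in> ?e \<longleftrightarrow> \<phi> a = x" using x aV by auto
    ultimately show ?thesis using d[of x] IH(3)[OF x] by simp
  qed
  show ?case unfolding eq using 1 2 3 by blast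
qed

text \<open>
  All spanning trees below are built by hanging a prescribed set \<open>W\<close> of leaves on a smaller tree; the
  vertices of the smaller tree are kept from being leaves by their degree in it plus the number of
  leaves they receive.
\<close>

lemma tree_on_attach_leaves:
  assumes T: "tree_on V T" "T \<subseteq> E" and W: "finite W" "W \<inter> V = {}"
    and adj: "\<And>w. w \<in> W \<Longrightarrow> \<phi> w \<in> V \<and> {w, \<phi> w} \<in> E"
    and deg2: "\<And>x. x \<in> V \<Longrightarrow> 2 \<le> deg T x + card {w \<in> W. \<phi> w = x}"
  shows "\<exists>T \<subseteq> E. tree_on (V \<union> W) T \<and> (\<forall>v \<in> V \<union> W. deg T v = 1 \<longleftrightarrow> v \<in> W)"
proof (intro exI conjI ballI)
  let ?T = "T \<union> (\<lambda>w. {w, \<phi> w}) ` W"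
  have a: "tree_on (V \<union> W) ?T" "\<And>w. w \<in> W \<Longrightarrow> deg ?T w = 1"
    "\<And>x. x \<in> V \<Longrightarrow> deg ?T x = deg T x + card {w \<in> W. \<phi> w = x}"
    using tree_on_attach[OF W(1) T(1) W(2), of \<phi>] adj by blast+
  show "?T \<subseteq> E" using T(2) adj by auto
  show "tree_on (V \<union> W) ?T" by (rule a(1))
  fix v assume v: "v \<in> V \<union> W"
  show "deg ?T v = 1 \<longleftrightarrow> v \<in> W"
  proof (cases "v \<in> W")
    case True
    then show ?thesis using a(2) by simp
  next
    case False
    then have "v \<in> V" using v by simp
    then show ?thesis using a(3)[of v] deg2[of v] False by simp
  qed
qed

fun path_edges :: "'a list \<Rightarrow> 'a set set" where
  "path_edges (x # y # zs) = insert {x, y} (path_edges (y # zs))"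
| "path_edges zs = {}"

lemma path_edges_subset:
  "successively (\<lambda>x y. {x, y} \<in> E) xs \<Longrightarrow> path_edges xs \<subseteq> E"
  by (induction xs rule: path_edges.induct) auto

text \<open>
  Counting the two ends of the list separately makes the statement right for one vertex as well,
  which is both ends at once.
\<close>

lemma tree_on_path:
  assumes "xs \<noteq> []" and "distinct xs"
  shows "tree_on (set xs) (path_edges xs) \<and>
    (\<forall>x \<in> set xs. 2 \<le> deg (path_edges xs) x + of_bool (x = hd xs) + of_bool (x = last xs))"
  using assms
proof (induction xs rule: path_edges.induct)
  case (1 x y zs)
  let ?P = "path_edges (y # zs)"
  have IH: "tree_on (set (y # zs)) ?P"
    "\<And>v. v \<in> set (y # zs) \<Longrightarrow> 2 \<le> deg ?P v + of_bool (v = y) + of_bool (v = last (y # zs))"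
    using 1 by auto
  have x: "x \<notin> set (y # zs)" using 1(3) by simp
  have eq: "?P \<union> (\<lambda>w. {w, y}) ` {x} = path_edges (x # y # zs)"
    "set (y # zs) \<union> {x} = set (x # y # zs)" by auto
  have a: "tree_on (set (x # y # zs)) (path_edges (x # y # zs))"
    "deg (path_edges (x # y # zs)) x = 1"
    "\<And>v. v \<in> set (y # zs) \<Longrightarrow>
       deg (path_edges (x # y # zs)) v = deg ?P v + card {w \<in> {x}. y = v}"
    using tree_on_attach[of "{x}" "set (y # zs)" ?P "\<lambda>_. y", unfolded eq] IH(1) x by auto
  have "2 \<le> deg (path_edges (x # y # zs)) v + of_bool (v = x) + of_bool (v = last (x # y # zs))"
    if v: "v \<in> set (x # y # zs)" for v
  proof (cases "v = x")
    case True
    then show ?thesis using a(2) by simp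
  next
    case False
    then have "v \<in> set (y # zs)" using v by simp
    moreover have "card {w \<in> {x}. y = v} = of_bool (v = y)" by (cases "v = y") auto
    ultimately show ?thesis using a(3)[of v] IH(2)[of v] by simp
  qed
  then show ?case using a(1) by simp
qed (auto simp: tree_on_def simple_on_def deg_def)

lemma finite_has_list:
  assumes "finite A"
  obtains xs where "set xs = A" "distinct xs" "length xs = card A"
  using finite_distinct_list[OF assms] distinct_card by metis

text \<open>
  One leaf \<open>s\<close> is hung on the last vertex of the path and the others on its first vertex. If the path is a
  single vertex, the tree is a star, whose centre is no leaf because there are at least two rays.
\<close>

lemma caterpillar_with_leaves:
  assumes xs: "xs \<noteq> []" "distinct xs" "successively (\<lambda>x y. {x, y} \<in> E) xs"
    and S: "finite S" "S \<inter> set xs = {}" "2 \<le> card S"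
    and s: "s \<in> S" "{s, last xs} \<in> E" and hd: "\<And>w. w \<in> S - {s} \<Longrightarrow> {w, hd xs} \<in> E"
  shows "\<exists>T \<subseteq> E. tree_on (set xs \<union> S) T \<and> (\<forall>v \<in> set xs \<union> S. deg T v = 1 \<longleftrightarrow> v \<in> S)"
proof -
  define \<phi> where "\<phi> w = (if w = s then last xs else hd xs)" for w
  note path = tree_on_path[OF xs(1,2)]
  have c1: "1 \<le> card (S - {s})" using S s by simp
  have ends: "of_bool (x = hd xs) + of_bool (x = last xs) \<le> card {w \<in> S. \<phi> w = x}" for x
  proof -
    consider "x = hd xs" "x = last xs" | "x = hd xs" "x \<noteq> last xs" | "x \<noteq> hd xs" "x = last xs"
      | "x \<noteq> hd xs" "x \<noteq> last xs" by blast
    then show ?thesis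
    proof cases
      case 1
      then have "{w \<in> S. \<phi> w = x} = S" by (auto simp: \<phi>_def)
      then show ?thesis using 1 S(3) by simp
    next
      case 2
      then have "{w \<in> S. \<phi> w = x} = S - {s}" by (auto simp: \<phi>_def)
      then show ?thesis using 2 c1 by simp
    next
      case 3
      then have "{w \<in> S. \<phi> w = x} = {s}" using s by (auto simp: \<phi>_def)
      then show ?thesis using 3 by simp
    qed simp
  qed
  show ?thesis
  proof (rule tree_on_attach_leaves[where \<phi> = \<phi> and T = "path_edges xs"])
    show "2 \<le> deg (path_edges xs) x + card {w \<in> S. \<phi> w = x}" if "x \<in> set xs" for x
    proof -
      have "2 \<le> deg (path_edges xs) x + of_bool (x = hd xs) + of_bool (x = last xs)"
        using path that by blast
      with ends[of x] show ?thesis by linarith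
    qed
    show "\<phi> w \<in> set xs \<and> {w, \<phi> w} \<in> E" if "w \<in> S" for w
      using that s hd xs(1) by (auto simp: \<phi>_def)
  qed (use path path_edges_subset[OF xs(3)] S in auto)
qed

lemma leaf_connected_on_complete:
  assumes V: "finite V" "2 \<le> k" "k + 1 \<le> card V"
    and complete: "\<And>x y. x \<in> V \<Longrightarrow> y \<in> V \<Longrightarrow> x \<noteq> y \<Longrightarrow> {x, y} \<in> E"
  shows "leaf_connected_on k V E"
  unfolding leaf_connected_on_def
proof (intro allI impI)
  fix S assume S: "S \<subseteq> V" "card S = k"
  have finS: "finite S" using S V finite_subset by blast
  obtain xs where xs: "set xs = V - S" "distinct xs"
    using finite_distinct_list[of "V - S"] V(1) by blast
  have "card (V - S) = card V - k" using S finS by (simp add: card_Diff_subset)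
  then have "card (V - S) \<noteq> 0" using V(3) by linarith
  then have "xs \<noteq> []" using xs(1) by (metis card.empty list.set(1))
  have "S \<noteq> {}" using S(2) V(2) by auto
  then obtain s where s: "s \<in> S" by blast
  have in_V: "hd xs \<in> V - S" "last xs \<in> V - S"
    using hd_in_set[OF \<open>xs \<noteq> []\<close>] last_in_set[OF \<open>xs \<noteq> []\<close>] xs(1) by simp_all
  have "sorted_wrt (\<lambda>x y. {x, y} \<in> E) xs"
    using xs(2) equalityD1[OF xs(1)] complete by (induction xs) auto
  then have "successively (\<lambda>x y. {x, y} \<in> E) xs" by (rule successively_if_sorted_wrt)
  moreover have "{s, last xs} \<in> E" "\<And>w. w \<in> S - {s} \<Longrightarrow> {w, hd xs} \<in> E"
    using s S(1) in_V by (auto intro!: complete)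
  ultimately have "\<exists>T \<subseteq> E. tree_on (set xs \<union> S) T \<and> (\<forall>v \<in> set xs \<union> S. deg T v = 1 \<longleftrightarrow> v \<in> S)"
    using \<open>xs \<noteq> []\<close> xs S(2) V(2) finS s by (intro caterpillar_with_leaves[where s = s]) auto
  moreover have "set xs \<union> S = V" using xs(1) S by auto
  ultimately show "\<exists>T \<subseteq> E. tree_on V T \<and> (\<forall>v \<in> V. deg T v = 1 \<longleftrightarrow> v \<in> S)"
    by simp
qed

text \<open>
  The spliced list starts in \<open>hs\<close>, and every entry of \<open>ls\<close> stands between two entries of \<open>hs\<close> or at
  the end.
\<close>

lemma successively_splice:
  "set hs \<subseteq> C \<Longrightarrow> length ls \<le> length hs \<Longrightarrow>
    successively (\<lambda>x y. x \<in> C \<or> y \<in> C) (splice hs ls)"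
proof (induction ls arbitrary: hs)
  case Nil
  then show ?case
    by (intro successively_if_sorted_wrt) (induction hs, auto)
next
  case (Cons l ls)
  then obtain h hs' where h: "hs = h # hs'" by (cases hs) auto
  then have "successively (\<lambda>x y. x \<in> C \<or> y \<in> C) (splice hs' ls)"
    using Cons by auto
  moreover have "splice hs' ls = [] \<or> hd (splice hs' ls) \<in> C"
    using Cons.prems h by (cases hs') auto
  ultimately show ?case using Cons.prems h by (auto simp: successively_Cons)
qed

lemma last_splice:
  "length ls < length hs \<Longrightarrow> last (splice hs ls) \<in> set hs"
proof (induction ls arbitrary: hs)
  case Nil
  then show ?case by auto
next
  case (Cons l ls)
  then obtain h hs' where "hs = h # hs'" by (cases hs) auto
  then show ?case using Cons by auto
qed

text \<open>
  The graph contains the join of the clique \<open>K\<^bsub>k+p\<^esub>\<close> on \<open>C\<close> with the \<open>p + 2\<close> isolated vertices of \<open>L\<close>.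
  There are \<open>2 p + 2\<close> vertices outside the prescribed leaf set \<open>S\<close>. If at least half of them lie in
  \<open>C\<close>, they can be arranged in a path alternating between the two parts, and a caterpillar on this
  path works. Otherwise all of \<open>L\<close> must be interior: then \<open>S \<subseteq> C\<close>, there are \<open>p\<close> interior vertices in \<open>C\<close> and
  \<open>p + 2\<close> in \<open>L\<close>. All but one of them form an alternating path with both ends in \<open>L\<close>, and the
  remaining one hangs on a vertex of this path; the resulting tree has three ends to be covered by \<open>S\<close>,
  whence \<open>k \<ge> 3\<close>.
\<close>

lemma leaf_connected_on_split_graph:
  assumes C: "finite C" "card C = k + p" and L: "finite L" "card L = p + 2" "C \<inter> L = {}"
    and k: "3 \<le> k" and p: "1 \<le> p"
    and adj: "\<And>x y. x \<in> C \<union> L \<Longrightarrow> y \<in> C \<union> L \<Longrightarrow> x \<noteq> y \<Longrightarrow> x \<in> C \<or> y \<in> C \<Longrightarrow> {x, y} \<in> E"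
  shows "leaf_connected_on k (C \<union> L) E"
  unfolding leaf_connected_on_def
proof (intro allI impI)
  fix S assume S: "S \<subseteq> C \<union> L" "card S = k"
  have finS: "finite S" using S(1) C(1) L(1) finite_subset by blast
  obtain hs where hs: "set hs = C - S" "distinct hs" "length hs = card (C - S)"
    using finite_has_list[of "C - S"] C(1) by blast
  obtain ls where ls: "set ls = L - S" "distinct ls" "length ls = card (L - S)"
    using finite_has_list[of "L - S"] L(1) by blast
  have "card (C - S) + card (L - S) = card (C \<union> L - S)"
    using C(1) L by (subst card_Un_disjoint[symmetric]) (auto intro: arg_cong[where f = card])
  also have "\<dots> = k + p + (p + 2) - k"
    using S finS C L by (simp add: card_Diff_subset card_Un_disjoint)
  finally have total: "length hs + length ls = 2 * p + 2" using hs(3) ls(3) by simp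
  have adj_list: "successively (\<lambda>x y. {x, y} \<in> E) xs"
    if "successively (\<lambda>x y. x \<in> C \<or> y \<in> C) xs" "set xs \<subseteq> C \<union> L" "distinct xs" for xs
    using that by (induction xs rule: path_edges.induct) (auto intro!: adj)
  show "\<exists>T \<subseteq> E. tree_on (C \<union> L) T \<and> (\<forall>v \<in> C \<union> L. deg T v = 1 \<longleftrightarrow> v \<in> S)"
  proof (cases "length ls \<le> length hs")
    case True
    define xs where "xs = splice hs ls"
    have hs0: "hs \<noteq> []" using True total by auto
    have shuf: "xs \<in> shuffles hs ls" unfolding xs_def by simp
    have set_xs: "set xs = (C - S) \<union> (L - S)"
      using set_shuffles[OF shuf] hs(1) ls(1) by simp
    have dist: "distinct xs"
      using distinct_disjoint_shuffles[OF hs(2) ls(2) _ shuf] hs(1) ls(1) L(3) by blast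
    have "xs \<noteq> []" using hs0 by (simp add: xs_def)
    have hd_xs: "hd xs \<in> C" using hs0 hs(1) unfolding xs_def by (cases hs) auto
    have last_xs: "last xs \<in> set xs" using \<open>xs \<noteq> []\<close> by simp
    have succ: "successively (\<lambda>x y. {x, y} \<in> E) xs"
      using successively_splice[of hs C ls] hs(1) True set_xs dist S(1)
      by (intro adj_list) (auto simp: xs_def)
    \<comment> \<open>if \<open>S\<close> misses \<open>C\<close>, the vertices of \<open>C\<close> are in the majority and the path ends in \<open>C\<close>\<close>
    obtain s where s: "s \<in> S" "s \<in> C \<or> last xs \<in> C"
    proof (cases "S \<inter> C = {}")
      case True
      then have "S \<subseteq> L" "C - S = C" using S(1) by auto
      then have "length hs = k + p" using hs(3) C(2) by simp
      then have "length ls < length hs" using total k p by linarith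
      then have "last xs \<in> C" using last_splice hs(1) unfolding xs_def by blast
      moreover have "S \<noteq> {}" using S(2) k by auto
      ultimately show thesis using that by blast
    qed (use that in blast)
    have "hd xs \<in> set xs" using \<open>xs \<noteq> []\<close> by simp
    then have "{w, hd xs} \<in> E" if "w \<in> S" for w
      using that hd_xs S(1) set_xs by (intro adj) auto
    moreover have "{s, last xs} \<in> E"
      using s last_xs S(1) set_xs by (intro adj) auto
    ultimately have "\<exists>T \<subseteq> E. tree_on (set xs \<union> S) T \<and> (\<forall>v \<in> set xs \<union> S. deg T v = 1 \<longleftrightarrow> v \<in> S)"
      using \<open>xs \<noteq> []\<close> dist succ finS s(1) set_xs S(2) k
      by (intro caterpillar_with_leaves[where s = s]) auto
    moreover have "set xs \<union> S = C \<union> L" using set_xs S(1) by auto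
    ultimately show ?thesis by simp
  next
    case False
    have "length ls \<le> p + 2" using ls(3) L(1,2) card_mono[of L "L - S"] by auto
    then have len: "length ls = p + 2" "length hs = p" using False total by linarith+
    have "L - S = L" using len(1) ls(3) L(1,2) by (intro card_subset_eq) auto
    then have SC: "S \<subseteq> C" using S(1) by auto
    obtain l ls' where l: "ls = l # ls'" using len(1) by (cases ls) auto
    define xs where "xs = splice ls' hs"
    have shuf: "xs \<in> shuffles ls' hs" unfolding xs_def by simp
    have set_xs: "set xs = set ls' \<union> (C - S)"
      using set_shuffles[OF shuf] hs(1) by simp
    have lsL: "set ls' \<subseteq> L - S" "l \<in> L - S" "l \<notin> set ls'" "distinct ls'"
      using ls(1,2) l by auto
    have "set ls' \<inter> set hs = {}" using lsL(1) hs(1) L(3) by blast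
    then have dist: "distinct xs"
      using distinct_disjoint_shuffles[OF lsL(4) hs(2) _ shuf] by blast
    have len_xs: "length xs = 2 * p + 1" using len l by (simp add: xs_def)
    have ne: "xs \<noteq> []" using len_xs by auto
    have hd_last: "hd xs \<noteq> last xs"
    proof
      assume "hd xs = last xs"
      then have "xs ! 0 = xs ! (2 * p)" using ne len_xs by (simp add: hd_conv_nth last_conv_nth)
      then show False using nth_eq_iff_index_eq[OF dist, of 0 "2 * p"] len_xs p by simp
    qed
    have succ: "successively (\<lambda>x y. {x, y} \<in> E) xs"
    proof (rule adj_list)
      obtain a as where a: "ls' = a # as" "length as = p" using len(1) l by (cases ls') auto
      have "successively (\<lambda>x y. x \<in> C \<or> y \<in> C) (splice hs as)"
        using hs(1) a(2) len(2) by (intro successively_splice) auto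
      moreover have "hd (splice hs as) \<in> C"
        using hs(1) len(2) p by (cases hs) auto
      ultimately show "successively (\<lambda>x y. x \<in> C \<or> y \<in> C) xs"
        unfolding xs_def a(1) by (simp add: successively_Cons)
    qed (use set_xs lsL dist in auto)
    obtain h where h: "h \<in> set hs" using len(2) p by (cases hs) auto
    have hC: "h \<in> C" "h \<in> set xs" using h hs(1) set_xs by auto
    have lx: "l \<notin> set xs" using set_xs lsL L(3) by auto
    have pe: "path_edges xs \<subseteq> E" by (rule path_edges_subset[OF succ])
    note path = tree_on_path[OF ne dist]
    define T where "T = path_edges xs \<union> (\<lambda>w. {w, h}) ` {l}"
    have T: "tree_on (set xs \<union> {l}) T" "deg T l = 1"
      "\<And>x. x \<in> set xs \<Longrightarrow> deg (path_edges xs) x \<le> deg T x"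
      using tree_on_attach[of "{l}" "set xs" "path_edges xs" "\<lambda>_. h"] path lx hC(2)
      unfolding T_def by auto
    have TE: "T \<subseteq> E" using pe hC(1) lsL(2) L(3) unfolding T_def by (auto intro!: adj)
    obtain R where R: "R \<subseteq> S" "card R = 2" using obtain_subset_with_card_n[of 2 S] S(2) k by auto
    then obtain s t where st: "s \<in> S" "t \<in> S" "s \<noteq> t" by (auto simp: card_2_iff)
    have "1 \<le> card (S - {s, t})"
      using st finS S(2) k by (simp add: card_Diff_subset)
    then have "S - {s, t} \<noteq> {}" by (metis card.empty not_one_le_zero)
    then obtain r where r: "r \<in> S" "r \<noteq> s" "r \<noteq> t" by blast
    \<comment> \<open>the three ends \<open>l\<close>, \<open>last xs\<close> and \<open>hd xs\<close> each receive a leaf, namely \<open>s\<close>, \<open>t\<close> and \<open>r\<close>\<close>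
    define \<phi> where "\<phi> w = (if w = s then l else if w = t then last xs else hd xs)" for w
    have ends: "hd xs \<in> set xs" "last xs \<in> set xs" using ne by auto
    have Sx: "S \<inter> (set xs \<union> {l}) = {}" using set_xs lsL SC L(3) by auto
    have cov: "1 \<le> card {w \<in> S. \<phi> w = x}" if "x = l \<or> x = hd xs \<or> x = last xs" for x
    proof -
      have "\<exists>w \<in> S. \<phi> w = x"
        using that st r by (auto simp: \<phi>_def)
      then have "{w \<in> S. \<phi> w = x} \<noteq> {}" by blast
      then show ?thesis using finS by (simp add: Suc_le_eq card_gt_0_iff)
    qed
    have "\<exists>T \<subseteq> E. tree_on (set xs \<union> {l} \<union> S) T \<and>
        (\<forall>v \<in> set xs \<union> {l} \<union> S. deg T v = 1 \<longleftrightarrow> v \<in> S)"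
    proof (rule tree_on_attach_leaves[where \<phi> = \<phi>, OF T(1) TE finS Sx])
      fix w assume w: "w \<in> S"
      have "\<phi> w \<in> set xs \<union> {l}" using ends by (auto simp: \<phi>_def)
      moreover have "\<phi> w \<in> C \<union> L" using calculation set_xs lsL by auto
      moreover have "w \<noteq> \<phi> w" using calculation(1) w Sx by auto
      ultimately show "\<phi> w \<in> set xs \<union> {l} \<and> {w, \<phi> w} \<in> E"
        using w SC by (auto intro!: adj)
    next
      fix x assume x: "x \<in> set xs \<union> {l}"
      show "2 \<le> deg T x + card {w \<in> S. \<phi> w = x}"
      proof (cases "x = l")
        case True
        then show ?thesis using T(2) cov[of l] by simp
      next
        case False
        then have xx: "x \<in> set xs" using x by simp
        have "2 \<le> deg (path_edges xs) x + of_bool (x = hd xs) + of_bool (x = last xs)"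
          using path xx by blast
        then show ?thesis
          using T(3)[OF xx] cov[of x] hd_last by (auto simp: of_bool_def split: if_splits)
      qed
    qed
    moreover have "set xs \<union> {l} \<union> S = C \<union> L"
      using set_xs lsL ls(1) l \<open>L - S = L\<close> SC by auto
    ultimately show ?thesis by (simp only:)
  qed
qed

section \<open>Degrees in graphs that are not leaf-connected\<close>

lemma deg_mono:
  assumes "E \<subseteq> H" and "finite H"
  shows "deg E v \<le> deg H v"
  unfolding deg_def using assms by (intro card_mono) auto

lemma card_non_neighbours:
  assumes "simple_on V E" and "v \<in> V"
  shows "card {w \<in> V. w \<noteq> v \<and> {v, w} \<notin> E} + deg E v + 1 = card V"
proof -
  have fin: "finite V" using assms(1) by (simp add: simple_on_def)
  have "{v, v} \<notin> E" using simple_onD(3)[OF assms(1)] by blast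
  then have "V = insert v ({w \<in> V. w \<noteq> v \<and> {v, w} \<notin> E} \<union> {w \<in> V. {v, w} \<in> E})"
    using assms(2) by auto
  also have "card \<dots> = 1 + card ({w \<in> V. w \<noteq> v \<and> {v, w} \<notin> E} \<union> {w \<in> V. {v, w} \<in> E})"
    using fin \<open>{v, v} \<notin> E\<close> by simp
  also have "card ({w \<in> V. w \<noteq> v \<and> {v, w} \<notin> E} \<union> {w \<in> V. {v, w} \<in> E}) =
      card {w \<in> V. w \<noteq> v \<and> {v, w} \<notin> E} + deg E v"
    using fin deg_eq_card_neighbours[OF assms(1), of v]
    by (subst card_Un_disjoint) auto
  finally show ?thesis by simp
qed

text \<open>
  Maximality makes every further edge produce a leaf-connected graph, so the closure theorem
  bounds all degree sums of non-adjacent vertices. A complete graph is leaf-connected, so some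
  non-adjacent pair is left.
\<close>

lemma edge_maximal_non_leaf_connected:
  assumes E: "simple_on V E" "\<not> leaf_connected_on k V E" and k: "2 \<le> k" "k + 1 \<le> card V"
  obtains H u v where "E \<subseteq> H" "simple_on V H" "u \<in> V" "v \<in> V" "u \<noteq> v" "{u, v} \<notin> H"
    and "\<forall>x \<in> V. \<forall>y \<in> V. x \<noteq> y \<longrightarrow> {x, y} \<notin> H \<longrightarrow> deg H x + deg H y + 2 \<le> card V + k"
proof -
  let ?M = "{H. E \<subseteq> H \<and> simple_on V H \<and> \<not> leaf_connected_on k V H}"
  have finV: "finite V" using E(1) by (simp add: simple_on_def)
  have "?M \<subseteq> Pow (Pow V)" by (auto simp: simple_on_def)
  then have "finite ?M" using finV by (meson finite_Pow_iff finite_subset)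
  moreover have "E \<in> ?M" using E by simp
  ultimately obtain H where H: "H \<in> ?M" and max: "\<forall>H' \<in> ?M. H \<subseteq> H' \<longrightarrow> H = H'"
    using finite_has_maximal2[of ?M E] by blast
  have "deg H x + deg H y + 2 \<le> card V + k"
    if xy: "x \<in> V" "y \<in> V" "x \<noteq> y" "{x, y} \<notin> H" for x y
  proof (rule leaf_connected_on_closure[OF _ xy])
    show "simple_on V H" "\<not> leaf_connected_on k V H" using H by simp_all
    have "simple_on V (insert {x, y} H)" using H xy by (auto simp: simple_on_def)
    then show "leaf_connected_on k V (insert {x, y} H)"
      using max H xy(4) by blast
  qed
  moreover have "\<exists>u \<in> V. \<exists>v \<in> V. u \<noteq> v \<and> {u, v} \<notin> H"
    using leaf_connected_on_complete[OF finV k, of H] H by blast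
  ultimately show thesis using that[of H] H by blast
qed

text \<open>
  Let \<open>u, v\<close> be a non-adjacent pair with \<open>d(u) + d(v)\<close> largest in an edge-maximal supergraph, and
  \<open>i = d(u) \<le> d(v)\<close>. By the choice of the pair, vertices not adjacent to \<open>v\<close> have degree at most \<open>d(u)\<close>,
  and vertices not adjacent to \<open>u\<close> have degree at most \<open>d(v)\<close>; both kinds are numerous because
  \<open>d(u) + d(v) \<le> n + k - 2\<close>. Instead of \<open>i\<close> and \<open>n\<close> the statement uses the slacks \<open>j = i - (k + 1)\<close> and
  \<open>s = n - (k + 4 + 2 j)\<close>, which avoids subtraction.
\<close>

lemma chvatal_partition:
  assumes E: "simple_on V E" "\<not> leaf_connected_on k V E" and k: "2 \<le> k" "k + 1 \<le> card V"
    and min: "\<And>v. v \<in> V \<Longrightarrow> k + 1 \<le> deg E v"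
  obtains A B C j s where "V = A \<union> B \<union> C" "A \<inter> B = {}" "A \<inter> C = {}" "B \<inter> C = {}"
    and "card V = k + 4 + 2 * j + s"
    and "card A = j + 2" "card B = s + 1" "card C = k + 1 + j"
    and "\<And>v. v \<in> A \<Longrightarrow> deg E v \<le> k + 1 + j" "\<And>v. v \<in> B \<Longrightarrow> deg E v \<le> k + 1 + j + s"
proof -
  obtain H u0 v0 where H: "E \<subseteq> H" "simple_on V H"
    and uv0: "u0 \<in> V" "v0 \<in> V" "u0 \<noteq> v0" "{u0, v0} \<notin> H"
    and small: "\<forall>x \<in> V. \<forall>y \<in> V. x \<noteq> y \<longrightarrow> {x, y} \<notin> H \<longrightarrow>
      deg H x + deg H y + 2 \<le> card V + k"
    by (rule edge_maximal_non_leaf_connected[OF E k])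
  have finV: "finite V" using E(1) by (simp add: simple_on_def)
  have le: "deg E v \<le> deg H v" for v
    using deg_mono[OF H(1)] simple_on_finite[OF H(2)] by blast
  define N where "N = {(x, y). x \<in> V \<and> y \<in> V \<and> x \<noteq> y \<and> {x, y} \<notin> H \<and> deg H x \<le> deg H y}"
  have "N \<subseteq> V \<times> V" by (auto simp: N_def)
  then have finN: "finite N" using finV finite_subset by blast
  have "(u0, v0) \<in> N \<or> (v0, u0) \<in> N" using uv0 by (auto simp: N_def insert_commute)
  then have "N \<noteq> {}" by blast
  define g where "g = (\<lambda>(x, y). deg H x + deg H y)"
  have "Max (g ` N) \<in> g ` N" using finN \<open>N \<noteq> {}\<close> by simp
  then obtain u v where uv: "(u, v) \<in> N" and mx: "Max (g ` N) = g (u, v)" by auto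
  have max: "deg H x + deg H y \<le> deg H u + deg H v"
    if "x \<in> V" "y \<in> V" "x \<noteq> y" "{x, y} \<notin> H" for x y
  proof -
    have "(x, y) \<in> N \<or> (y, x) \<in> N" using that by (auto simp: N_def insert_commute)
    moreover have "g z \<le> g (u, v)" if "z \<in> N" for z
      unfolding mx[symmetric] by (rule Max_ge) (use that finN in simp_all)
    ultimately have "g (x, y) \<le> g (u, v) \<or> g (y, x) \<le> g (u, v)" by blast
    then show ?thesis by (auto simp: g_def)
  qed
  have u: "u \<in> V" "v \<in> V" "u \<noteq> v" "{u, v} \<notin> H" "deg H u \<le> deg H v"
    using uv by (auto simp: N_def)
  define j where "j = deg H u - (k + 1)"
  have du: "deg H u = k + 1 + j" using min[OF u(1)] le[of u] by (simp add: j_def)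
  define s where "s = card V - (k + 4 + 2 * j)"
  have sum: "deg H u + deg H v + 2 \<le> card V + k" using small u(1-4) by blast
  have n: "card V = k + 4 + 2 * j + s" using sum u(5) du by (simp add: s_def)
  define A' where "A' = {w \<in> V. w \<noteq> v \<and> {v, w} \<notin> H}"
  define B' where "B' = insert u {w \<in> V. w \<noteq> u \<and> {u, w} \<notin> H}"
  have "card A' + deg H v + 1 = card V"
    unfolding A'_def by (rule card_non_neighbours[OF H(2) u(2)])
  then have "j + 2 \<le> card A'" using sum du by linarith
  then obtain A where A: "A \<subseteq> A'" "card A = j + 2"
    by (rule obtain_subset_with_card_n)
  have finB': "finite B'" using finV by (simp add: B'_def)
  have "card B' = Suc (card {w \<in> V. w \<noteq> u \<and> {u, w} \<notin> H})"
    using finV by (simp add: B'_def)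
  then have cB: "card B' = j + 3 + s"
    using card_non_neighbours[OF H(2) u(1)] du n by linarith
  have fin: "finite A'" "finite A" "finite B'" "finite (A \<union> B')"
    using finV finB' A(1) by (auto simp: A'_def intro: finite_subset)
  have "card B' \<le> card (A \<union> B')" using fin by (intro card_mono) auto
  then have "\<exists>L. A \<subseteq> L \<and> L \<subseteq> A \<union> B' \<and> card L = j + 3 + s"
    using A(2) cB fin by (intro exists_subset_between) auto
  then obtain L where L: "A \<subseteq> L" "L \<subseteq> A \<union> B'" "card L = j + 3 + s" by blast
  have "A \<union> B' \<subseteq> V" using A(1) u(1) by (auto simp: A'_def B'_def)
  then have LV: "L \<subseteq> V" using L(2) by blast
  then have finL: "finite L" using finV finite_subset by blast
  have dA: "deg E w \<le> k + 1 + j" if "w \<in> A" for w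
    using max[of v w] that A(1) u(2) du le[of w] by (fastforce simp: A'_def)
  have dB: "deg E w \<le> k + 1 + j + s" if "w \<in> B'" for w
  proof -
    have "deg H w \<le> deg H v"
      using max[of u w] that u(1,5) by (fastforce simp: B'_def)
    moreover have "deg H v \<le> k + 1 + j + s" using sum du n by linarith
    ultimately show ?thesis using le[of w] by linarith
  qed
  show thesis
  proof (rule that[of A "L - A" "V - L" j s])
    show "V = A \<union> (L - A) \<union> (V - L)" using L(1) LV by blast
    show "card (L - A) = s + 1" using L(1,3) A(2) finL fin by (simp add: card_Diff_subset)
    show "card (V - L) = k + 1 + j" using LV L(3) n finL by (simp add: card_Diff_subset)
    show "deg E v \<le> k + 1 + j + s" if "v \<in> L - A" for v
      using that L(2) dB by blast
  qed (use A(2) n dA L(1) in auto)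
qed

section \<open>The hyper-Zagreb index and the sum of cubes of degrees\<close>

lemma sum_deg_weighted:
  fixes f :: "'a \<Rightarrow> nat"
  assumes "simple_on V E"
  shows "(\<Sum>v \<in> V. f v * deg E v) = (\<Sum>e \<in> E. \<Sum>v \<in> e. f v)"
proof -
  have fin: "finite V" "finite E"
    using assms simple_on_finite[OF assms] by (auto simp: simple_on_def)
  have "(\<Sum>v \<in> V. f v * deg E v) = (\<Sum>v \<in> V. \<Sum>e \<in> E. f v * of_bool (v \<in> e))"
    by (simp add: deg_eq_sum[OF fin(2)] sum_distrib_left del: sum_of_bool_eq sum_mult_of_bool_eq)
  also have "\<dots> = (\<Sum>e \<in> E. \<Sum>v \<in> V. f v * of_bool (v \<in> e))" by (rule sum.swap)
  also have "\<dots> = (\<Sum>e \<in> E. \<Sum>v \<in> e. f v)"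
  proof (rule sum.cong[OF refl])
    fix e assume "e \<in> E"
    then have "V \<inter> e = e" using assms by (auto simp: simple_on_def)
    then show "(\<Sum>v \<in> V. f v * of_bool (v \<in> e)) = (\<Sum>v \<in> e. f v)"
      using fin by (simp add: sum_mult_of_bool_eq)
  qed
  finally show ?thesis .
qed

lemma even_sum_deg:
  assumes "simple_on V E"
  shows "even (\<Sum>v \<in> V. deg E v)"
proof -
  have "(\<Sum>v \<in> V. deg E v) = (\<Sum>e \<in> E. card e)"
    using sum_deg_weighted[OF assms, of "\<lambda>_. 1"] by simp
  also have "\<dots> = (\<Sum>e \<in> E. 2)"
    using assms by (intro sum.cong) (auto simp: simple_on_def)
  finally show ?thesis by simp
qed

lemma full_degree_adjacent:
  assumes "simple_on V E" "x \<in> V" "y \<in> V" "x \<noteq> y" "deg E x + 1 = card V"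
  shows "{x, y} \<in> E"
proof -
  have "card {w \<in> V. w \<noteq> x \<and> {x, w} \<notin> E} = 0"
    using card_non_neighbours[OF assms(1,2)] assms(5) by linarith
  moreover have "finite {w \<in> V. w \<noteq> x \<and> {x, w} \<notin> E}"
    using assms(1) by (simp add: simple_on_def)
  ultimately show ?thesis using assms(3,4) by auto
qed

definition hyper_zagreb_edges :: "'a set set \<Rightarrow> nat" where
  "hyper_zagreb_edges E = (\<Sum>e \<in> E. (\<Sum>v \<in> e. deg E v)\<^sup>2)"

text \<open>
  The inequality \<open>(p + q)\<^sup>2 + (p - q)\<^sup>2 \<le> 2 (p\<^sup>2 + q\<^sup>2)\<close>, summed over all edges, where the second
  square is kept only for the edges between the full vertices in \<open>F\<close> and the vertices of small degree
  in \<open>A\<close>. All these edges exist because full vertices are adjacent to everything.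
\<close>

lemma hyper_zagreb_deficit:
  assumes E: "simple_on V E" and n: "card V = c + 1"
    and FA: "F \<subseteq> V" "A \<subseteq> V" "F \<inter> A = {}"
    and F: "\<And>x. x \<in> F \<Longrightarrow> deg E x = c" and A: "\<And>x. x \<in> A \<Longrightarrow> deg E x \<le> a" and ac: "a \<le> c"
  shows "hyper_zagreb_edges E + card F * card A * (c - a)\<^sup>2 \<le> 2 * (\<Sum>v \<in> V. deg E v ^ 3)"
proof -
  have fin: "finite V" "finite E"
    using E simple_on_finite[OF E] by (auto simp: simple_on_def)
  define P where "P = (\<lambda>(x, y). {x, y}) ` (F \<times> A)"
  have PE: "P \<subseteq> E"
    using full_degree_adjacent[OF E] F n FA by (fastforce simp: P_def)
  have "inj_on (\<lambda>(x, y). {x, y}) (F \<times> A)"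
    using FA(3) by (auto intro!: inj_onI simp: doubleton_eq_iff)
  then have cP: "card P = card F * card A"
    by (simp add: P_def card_image card_cartesian_product)
  have edge: "(\<Sum>v \<in> e. deg E v)\<^sup>2 + (if e \<in> P then (c - a)\<^sup>2 else 0) \<le> 2 * (\<Sum>v \<in> e. (deg E v)\<^sup>2)"
    if e: "e \<in> E" for e
  proof (cases "e \<in> P")
    case False
    obtain x y where xy: "e = {x, y}" "x \<noteq> y" using simple_on_edgeE[OF E e] by blast
    have "(int (deg E x) + int (deg E y))\<^sup>2 \<le> 2 * ((int (deg E x))\<^sup>2 + (int (deg E y))\<^sup>2)"
      using zero_le_power2[of "int (deg E x) - int (deg E y)"]
      by (simp add: power2_eq_square algebra_simps)
    then have "int ((deg E x + deg E y)\<^sup>2) \<le> int (2 * ((deg E x)\<^sup>2 + (deg E y)\<^sup>2))"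
      by simp
    then have "(deg E x + deg E y)\<^sup>2 \<le> 2 * ((deg E x)\<^sup>2 + (deg E y)\<^sup>2)"
      by (simp only: of_nat_le_iff)
    then show ?thesis using False xy by simp
  next
    case True
    then obtain x y where xy: "e = {x, y}" "x \<in> F" "y \<in> A" by (auto simp: P_def)
    have ne: "x \<noteq> y" using xy FA(3) by blast
    obtain t where t: "a = deg E y + t" using A[OF xy(3)] le_Suc_ex by blast
    obtain r where r: "c = a + r" using ac le_Suc_ex by blast
    show ?thesis
      using True xy ne F[OF xy(2)] t r by (simp add: power2_eq_square algebra_simps)
  qed
  have "hyper_zagreb_edges E + card F * card A * (c - a)\<^sup>2 =
      (\<Sum>e \<in> E. (\<Sum>v \<in> e. deg E v)\<^sup>2 + (if e \<in> P then (c - a)\<^sup>2 else 0))"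
    using fin(2) PE cP by (simp add: hyper_zagreb_edges_def sum.distrib sum.If_cases Int_absorb1)
  also have "\<dots> \<le> (\<Sum>e \<in> E. 2 * (\<Sum>v \<in> e. (deg E v)\<^sup>2))"
    by (rule sum_mono) (rule edge)
  also have "\<dots> = 2 * (\<Sum>v \<in> V. (deg E v)\<^sup>2 * deg E v)"
    by (simp add: sum_deg_weighted[OF E] sum_distrib_left)
  finally show ?thesis by (simp add: power2_eq_square power3_eq_cube)
qed

text \<open>
  The upper bounds on the degrees in the three classes limit the sum of cubes; \<open>loss\<close> records by how
  much each vertex stays below its bound.
\<close>

lemma degree_budget:
  assumes E: "simple_on V E" and V: "V = A \<union> B \<union> C" "A \<inter> B = {}" "A \<inter> C = {}" "B \<inter> C = {}"
    and n: "card V = c + 1"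
    and dA: "\<And>v. v \<in> A \<Longrightarrow> deg E v \<le> a" and dB: "\<And>v. v \<in> B \<Longrightarrow> deg E v \<le> b" and ac: "a \<le> c"
  defines "loss v \<equiv> (if v \<in> A then a ^ 3 else if v \<in> B then b ^ 3 else c ^ 3) - deg E v ^ 3"
  shows "hyper_zagreb_edges E + card {v \<in> C. deg E v = c} * card A * (c - a)\<^sup>2 + 2 * (\<Sum>v \<in> V. loss v)
    \<le> 2 * (card A * a ^ 3 + card B * b ^ 3 + card C * c ^ 3)"
proof -
  have finV: "finite V" using E by (simp add: simple_on_def)
  then have fin: "finite A" "finite B" "finite C" using V(1) by auto
  define cap where "cap v = (if v \<in> A then a ^ 3 else if v \<in> B then b ^ 3 else c ^ 3)" for v
  have dc: "deg E v \<le> c" if "v \<in> V" for v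
    using card_non_neighbours[OF E that] n by linarith
  have "deg E v ^ 3 \<le> cap v" if "v \<in> V" for v
    using that dA dB dc by (auto simp: cap_def intro: power_mono)
  then have "(\<Sum>v \<in> V. deg E v ^ 3) + (\<Sum>v \<in> V. loss v) = (\<Sum>v \<in> V. cap v)"
    unfolding sum.distrib[symmetric] by (intro sum.cong) (auto simp: loss_def cap_def)
  also have "\<dots> = (\<Sum>v \<in> A \<union> B. cap v) + (\<Sum>v \<in> C. cap v)"
    unfolding V(1) using fin V by (intro sum.union_disjoint) auto
  also have "(\<Sum>v \<in> A \<union> B. cap v) = (\<Sum>v \<in> A. cap v) + (\<Sum>v \<in> B. cap v)"
    using fin V by (intro sum.union_disjoint) auto
  also have "(\<Sum>v \<in> A. cap v) = card A * a ^ 3" by (simp add: cap_def)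
  also have "(\<Sum>v \<in> B. cap v) = (\<Sum>v \<in> B. b ^ 3)"
    using V(2) by (intro sum.cong) (auto simp: cap_def)
  also have "(\<Sum>v \<in> C. cap v) = (\<Sum>v \<in> C. c ^ 3)"
    using V(3,4) by (intro sum.cong) (auto simp: cap_def)
  finally have total: "(\<Sum>v \<in> V. deg E v ^ 3) + (\<Sum>v \<in> V. loss v) =
      card A * a ^ 3 + card B * b ^ 3 + card C * c ^ 3" by simp
  have "hyper_zagreb_edges E + card {v \<in> C. deg E v = c} * card A * (c - a)\<^sup>2 \<le> 2 * (\<Sum>v \<in> V. deg E v ^ 3)"
    by (rule hyper_zagreb_deficit[OF E n _ _ _ _ dA ac]) (use V in auto)
  then show ?thesis unfolding total[symmetric] by simp
qed

section \<open>Comparison with the threshold\<close>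

lemma cube_drop:
  fixes d m :: nat
  assumes "d \<le> m"
  shows "3 * m\<^sup>2 + 3 * m + 1 \<le> (m + 1) ^ 3 - d ^ 3"
proof -
  have "d ^ 3 \<le> m ^ 3" using assms by (rule power_mono) simp
  moreover have "(m + 1) ^ 3 = m ^ 3 + 3 * m\<^sup>2 + 3 * m + 1"
    by (simp add: power2_eq_square power3_eq_cube algebra_simps
      del: One_nat_def add_2_eq_Suc add_2_eq_Suc')
  ultimately show ?thesis by linarith
qed

lemma cube_drop2:
  fixes d m :: nat
  assumes "d + 1 \<le> m"
  shows "6 * m\<^sup>2 + 2 \<le> (m + 1) ^ 3 - d ^ 3"
proof -
  obtain q where q: "m = q + 1" "d \<le> q"
    using assms by (metis Suc_eq_plus1 Suc_le_D Suc_le_mono)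
  have "d ^ 3 \<le> q ^ 3" using q(2) by (rule power_mono) simp
  moreover have "(m + 1) ^ 3 = q ^ 3 + 6 * m\<^sup>2 + 2"
    by (simp add: q(1) power2_eq_square power3_eq_cube algebra_simps
      del: One_nat_def add_2_eq_Suc add_2_eq_Suc')
  ultimately show ?thesis by linarith
qed

text \<open>
  Twice the largest conceivable sum of cubes of degrees for the partition obtained in
  \<open>chvatal_partition\<close>. The order of the graph is \<open>n = k + 4 + 2 j + s\<close>, so \<open>capacity k 0 (2 * j + s)\<close> is
  the value at \<open>j = 0\<close> for the same \<open>n\<close> and \<open>k\<close>, and this is the threshold of the theorem.
\<close>

definition capacity :: "nat \<Rightarrow> nat \<Rightarrow> nat \<Rightarrow> nat" where
  "capacity k j s = 2 * ((j + 2) * (k + 1 + j) ^ 3 + (s + 1) * (k + 1 + j + s) ^ 3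
     + (k + 1 + j) * (k + 3 + 2 * j + s) ^ 3)"

text \<open>
  Half the difference is a polynomial in \<open>K = k + 1\<close> with leading term \<open>3 j (j + 2 s - 3) K\<^sup>2\<close>, which
  explains the excluded pairs. After shifting the variables by their lower bounds all coefficients are positive.
\<close>

lemma capacity_less:
  fixes k j s :: nat
  assumes "2 \<le> k" and "4 \<le> j \<or> j = 3 \<and> 1 \<le> s \<or> j = 2 \<and> 1 \<le> s \<or> j = 1 \<and> 2 \<le> s"
  shows "capacity k j s < capacity k 0 (2 * j + s)"
proof -
  obtain l where k: "k = l + 2" using assms(1) by (metis add.commute le_Suc_ex)
  consider "4 \<le> j" | "j = 3" "1 \<le> s" | "j = 2" "1 \<le> s" | "j = 1" "2 \<le> s"
    using assms(2) by blast
  then show ?thesis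
  proof cases
    case 1
    then obtain i where e: "j = i + 4" by (metis add.commute le_Suc_ex)
    show ?thesis unfolding e k by (simp add: capacity_def power3_eq_cube algebra_simps
      del: One_nat_def add_2_eq_Suc add_2_eq_Suc')
  next
    case 2
    then obtain t where e: "s = t + 1" by (metis add.commute le_Suc_ex)
    show ?thesis unfolding e 2(1) k by (simp add: capacity_def power3_eq_cube algebra_simps
      del: One_nat_def add_2_eq_Suc add_2_eq_Suc')
  next
    case 3
    then obtain t where e: "s = t + 1" by (metis add.commute le_Suc_ex)
    show ?thesis unfolding e 3(1) k by (simp add: capacity_def power3_eq_cube algebra_simps
      del: One_nat_def add_2_eq_Suc add_2_eq_Suc')
  next
    case 4
    then obtain t where e: "s = t + 2" by (metis add.commute le_Suc_ex)
    show ?thesis unfolding e 4(1) k by (simp add: capacity_def power3_eq_cube algebra_simps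
      del: One_nat_def add_2_eq_Suc add_2_eq_Suc')
  qed
qed

lemma capacity_exceptional:
  "capacity k 1 1 = capacity k 0 3 + 72"
  "capacity k 1 0 = capacity k 0 2 + 12 * k\<^sup>2 + 72 * k + 148"
  "capacity k 2 0 = capacity k 0 4 + 12 * k\<^sup>2 + 96 * k + 388"
  "capacity k 3 0 + 36 * k = capacity k 0 6 + 336"
  by (simp_all add: capacity_def power2_eq_square power3_eq_cube algebra_simps
      del: One_nat_def add_2_eq_Suc add_2_eq_Suc')

lemma capacity_threshold:
  assumes "n = k + 4 + m"
  shows "int (capacity k 0 m) = 2 * int n ^ 4 - 22 * int n ^ 3 + (12 * int k + 102) * int n ^ 2
           - (48 * int k + 210) * int n
           + 4 * int k ^ 3 + 12 * int k ^ 2 + 64 * int k + 164"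
  by (simp add: assms capacity_def power2_eq_square power3_eq_cube power4_eq_xxxx algebra_simps
      del: One_nat_def add_2_eq_Suc add_2_eq_Suc')

section \<open>The exceptional graphs\<close>

lemma split_graph_isomorphic:
  assumes V: "verts G = C \<union> L" "C \<inter> L = {}" and fin: "finite C" "finite L"
    and E: "\<And>x y. x \<in> C \<union> L \<Longrightarrow> y \<in> C \<union> L \<Longrightarrow> {x, y} \<in> edges G \<longleftrightarrow> x \<noteq> y \<and> (x \<in> C \<or> y \<in> C)"
  shows "graph_isomorphic G (graph_join (complete_graph (card C)) (copies (card L) (complete_graph 1)))"
    (is "graph_isomorphic G ?J")
proof -
  define J where "J = ?J"
  obtain g where g: "bij_betw g C {0..<card C}" using ex_bij_betw_finite_nat[OF fin(1)] by blast
  obtain h where h: "bij_betw h L {0..<card L}" using ex_bij_betw_finite_nat[OF fin(2)] by blast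
  define f where "f x = (if x \<in> C then Inl (g x) else Inr (h x, 0 :: nat))" for x
  have K1: "edges (complete_graph 1) = {}" "verts (complete_graph 1) = {0}"
    by (auto simp: complete_graph_def)
  have vJ: "verts J = Inl ` {..<card C} \<union> Inr ` ({..<card L} \<times> {0})"
    by (auto simp: J_def graph_join_def disjoint_union_def copies_def K1 complete_graph_def)
  have eJ: "edges J = {{Inl u, Inl v} | u v. u < card C \<and> v < card C \<and> u \<noteq> v} \<union>
      {{Inl u, Inr (v, 0)} | u v. u < card C \<and> v < card L}"
  proof -
    have "edges J = (`) Inl ` {{u, v} | u v. u < card C \<and> v < card C \<and> u \<noteq> v} \<union>
      {{Inl u, Inr v} | u v. u < card C \<and> v \<in> {..<card L} \<times> {0}}"
      by (simp add: J_def graph_join_def disjoint_union_def copies_def K1)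
        (simp add: complete_graph_def)
    also have "(`) Inl ` {{u, v} | u v. u < card C \<and> v < card C \<and> u \<noteq> v} =
        {{Inl u, Inl v} | u v. u < card C \<and> v < card C \<and> u \<noteq> v}"
      by (auto simp: image_iff) (metis image_empty image_insert)
    finally show ?thesis by auto
  qed
  have gC: "g x < card C" if "x \<in> C" for x using bij_betwE[OF g] that by auto
  have hL: "h x < card L" if "x \<in> L" for x using bij_betwE[OF h] that by auto
  have ginj: "g x = g y \<longleftrightarrow> x = y" if "x \<in> C" "y \<in> C" for x y
    using bij_betw_imp_inj_on[OF g] that by (auto dest: inj_onD)
  have "bij_betw f C (Inl ` {..<card C})"
  proof -
    have "bij_betw (Inl \<circ> g) C (Inl ` {..<card C})"
      using g by (intro bij_betw_trans[OF g]) (auto simp: bij_betw_def atLeast0LessThan)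
    then show ?thesis by (rule bij_betw_cong[THEN iffD1, rotated]) (simp add: f_def)
  qed
  moreover have "bij_betw f L (Inr ` ({..<card L} \<times> {0}))"
  proof -
    have "bij_betw (\<lambda>i. Inr (i, 0 :: nat)) {0..<card L} (Inr ` ({..<card L} \<times> {0}))"
      by (auto simp: bij_betw_def inj_on_def)
    from bij_betw_trans[OF h this] show ?thesis
      by (rule bij_betw_cong[THEN iffD1, rotated]) (use V(2) in \<open>auto simp: f_def\<close>)
  qed
  ultimately have "bij_betw f (verts G) (verts J)"
    unfolding V(1) vJ by (rule bij_betw_combine) auto
  moreover have "{x, y} \<in> edges G \<longleftrightarrow> {f x, f y} \<in> edges J"
    if xy: "x \<in> verts G" "y \<in> verts G" for x y
  proof -
    have "{f x, f y} \<in> edges J \<longleftrightarrow> x \<noteq> y \<and> (x \<in> C \<or> y \<in> C)"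
    proof (cases "x \<in> C"; cases "y \<in> C")
      assume C: "x \<in> C" "y \<in> C"
      have "{Inl (g x), Inl (g y)} \<in> edges J \<longleftrightarrow> g x \<noteq> g y"
        using gC[OF C(1)] gC[OF C(2)] unfolding eJ by (fastforce simp: doubleton_eq_iff)
      then show ?thesis using C ginj by (simp add: f_def)
    next
      assume "x \<in> C" "y \<notin> C"
      then show ?thesis using gC hL xy V(1) by (auto simp: f_def eJ doubleton_eq_iff)
    next
      assume "x \<notin> C" "y \<in> C"
      then show ?thesis using gC hL xy V(1) by (auto simp: f_def eJ doubleton_eq_iff)
    next
      assume "x \<notin> C" "y \<notin> C"
      then show ?thesis by (auto simp: f_def eJ doubleton_eq_iff)
    qed
    then show ?thesis using E xy V(1) by simp
  qed
  ultimately show ?thesis unfolding J_def[symmetric] graph_isomorphic_def by blast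
qed

text \<open>
  Here \<open>C - F\<close> consists of the vertices of \<open>C\<close> that are not full. The hypothesis leaves at most
  \<open>capacity k j s - capacity k 0 (2 * j + s)\<close> to be spent on the deficits of edges between \<open>F\<close> and \<open>A\<close> and on
  losses of degree, and every vertex of \<open>C\<close> causes one or the other. For \<open>(j, s)\<close> equal to \<open>(1, 0)\<close> or \<open>(2, 0)\<close>
  two vertices of \<open>C - F\<close> are too expensive, and so is one of degree less than \<open>n - 2\<close>. A single one of
  degree \<open>n - 2\<close> alone would be affordable for large \<open>k\<close>, but then the degree sum is odd unless some vertex
  outside \<open>C\<close> also misses its bound, and both losses together exceed the budget.
\<close>

lemma only_split_graphs:
  assumes E: "simple_on V E" and k: "2 \<le> k"
    and V: "V = A \<union> B \<union> C" "A \<inter> B = {}" "A \<inter> C = {}" "B \<inter> C = {}"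
    and n: "card V = k + 4 + 2 * j + s"
    and card: "card A = j + 2" "card B = s + 1" "card C = k + 1 + j"
    and dA: "\<And>v. v \<in> A \<Longrightarrow> deg E v \<le> k + 1 + j" and dB: "\<And>v. v \<in> B \<Longrightarrow> deg E v \<le> k + 1 + j + s"
    and large: "capacity k 0 (2 * j + s) \<le> hyper_zagreb_edges E"
  shows "(j = 1 \<or> j = 2) \<and> s = 0 \<and> (\<forall>v \<in> C. deg E v + 1 = card V)"
proof -
  define m where "m = k + 2 + 2 * j + s"
  define F where "F = {v \<in> C. deg E v = m + 1}"
  define loss where "loss v = (if v \<in> A then (k + 1 + j) ^ 3 else if v \<in> B then (k + 1 + j + s) ^ 3
    else (m + 1) ^ 3) - deg E v ^ 3" for v
  define cost where "cost = 3 * m\<^sup>2 + 3 * m + 1"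
  have finV: "finite V" using E by (simp add: simple_on_def)
  then have finC: "finite C" using V(1) by auto
  have cm: "m + 1 = k + 3 + 2 * j + s" by (simp add: m_def)
  have "hyper_zagreb_edges E + card F * card A * (m + 1 - (k + 1 + j))\<^sup>2 + 2 * (\<Sum>v \<in> V. loss v)
      \<le> 2 * (card A * (k + 1 + j) ^ 3 + card B * (k + 1 + j + s) ^ 3 + card C * (m + 1) ^ 3)"
    unfolding F_def loss_def
    by (rule degree_budget[OF E V _ dA dB]) (simp_all add: n m_def)
  also have "\<dots> = capacity k j s"
    unfolding card cm capacity_def by simp
  finally have budget: "hyper_zagreb_edges E + card F * ((j + 2) * (2 + j + s)\<^sup>2) + 2 * (\<Sum>v \<in> V. loss v)
      \<le> capacity k j s"
    by (simp add: card m_def algebra_simps)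
  have CF: "C - F \<subseteq> V" "finite (C - F)" using V(1) finC by auto
  have F: "F \<subseteq> C" by (auto simp: F_def)
  have cF: "card F + card (C - F) = k + 1 + j"
    using card(3) F finC by (metis add.commute card_Diff_subset card_mono finite_subset le_add_diff_inverse2)
  have dm: "deg E v \<le> m" if "v \<in> C - F" for v
    using card_non_neighbours[OF E, of v] n that CF(1) by (auto simp: F_def m_def)
  have loss_C: "loss v = (m + 1) ^ 3 - deg E v ^ 3" if "v \<in> C" for v
    using that V(3,4) by (auto simp: loss_def)
  have "card (C - F) * cost = (\<Sum>v \<in> C - F. cost)" by simp
  also have "\<dots> \<le> (\<Sum>v \<in> C - F. loss v)"
    using cube_drop[OF dm] loss_C by (intro sum_mono) (auto simp: cost_def)
  also have "\<dots> \<le> (\<Sum>v \<in> V. loss v)"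
    using finV CF(1) by (intro sum_mono2) auto
  finally have cost: "card (C - F) * cost \<le> (\<Sum>v \<in> V. loss v)" .
  have pair_loss: "loss v + loss w \<le> (\<Sum>v \<in> V. loss v)" if "v \<in> V" "w \<in> V" "v \<noteq> w" for v w
    using sum_mono2[of V "{v, w}" loss] finV that by simp
  have star: "capacity k 0 (2 * j + s) + card F * ((j + 2) * (2 + j + s)\<^sup>2)
      + 2 * (card (C - F) * cost) \<le> capacity k j s"
    using budget cost large by linarith
  have cost_ge: "61 \<le> cost"
  proof -
    have "4 * 4 \<le> m * m" using k by (intro mult_le_mono) (auto simp: m_def)
    then show ?thesis using k by (simp add: cost_def power2_eq_square m_def)
  qed
  have costs: "61 * card (C - F) \<le> card (C - F) * cost"
    using cost_ge by simp
  have star_weak: "capacity k 0 (2 * j + s) + card F * ((j + 2) * (2 + j + s)\<^sup>2)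
      + 2 * (61 * card (C - F)) \<le> capacity k j s"
    using star costs by linarith
  have "\<not> (4 \<le> j \<or> j = 3 \<and> 1 \<le> s \<or> j = 2 \<and> 1 \<le> s \<or> j = 1 \<and> 2 \<le> s)"
    using capacity_less[OF k, of j s] star by linarith
  then consider "j = 0" | "j = 1" "s = 1" | "j = 3" "s = 0" | "j = 1 \<or> j = 2" "s = 0"
    by linarith
  then show ?thesis
  proof cases
    case 1
    have "card F * (2 * 4) \<le> card F * (2 * (2 + s)\<^sup>2)"
      by (intro mult_le_mono) (simp_all add: power2_eq_square)
    then show ?thesis using star_weak cF 1 by simp
  next
    case 2
    then show ?thesis using star_weak cF k capacity_exceptional(1)[of k] by simp
  next
    case 3
    then show ?thesis using star_weak cF k capacity_exceptional(4)[of k] by simp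
  next
    case 4
    have "card (C - F) = 0"
    proof (rule ccontr)
      assume "card (C - F) \<noteq> 0"
      then consider "2 \<le> card (C - F)" | "card (C - F) = 1" by linarith
      then show False
      proof cases
        case 1
        then have "2 * (2 * cost) \<le> 2 * (card (C - F) * cost)" by simp
        then have "capacity k 0 (2 * j + s) + 2 * (2 * cost) \<le> capacity k j s"
          using star by linarith
        then show False
          using 4 capacity_exceptional(2,3)[of k]
          by (auto simp: cost_def m_def power2_eq_square algebra_simps
            simp del: One_nat_def add_2_eq_Suc add_2_eq_Suc')
      next
        case one: 2
        then obtain w where w: "C - F = {w}" by (rule card_1_singletonE)
        have wV: "w \<in> V" "w \<in> C" "w \<notin> F" using w CF(1) by auto
        show False
        proof (cases "deg E w = m")
          case False
          then have "deg E w + 1 \<le> m" using dm[of w] w by auto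
          then have "6 * m\<^sup>2 + 2 \<le> loss w" using cube_drop2 loss_C[OF wV(2)] by simp
          also have "\<dots> \<le> (\<Sum>v \<in> V. loss v)"
            using finV wV(1) by (intro member_le_sum) auto
          finally have dw: "6 * m\<^sup>2 + 2 \<le> (\<Sum>v \<in> V. loss v)" .
          have total: "hyper_zagreb_edges E + 2 * (\<Sum>v \<in> V. loss v) \<le> capacity k j s"
            by (rule order_trans[OF _ budget]) simp
          have "capacity k 0 (2 * j + s) + 2 * (6 * m\<^sup>2 + 2) \<le> capacity k j s"
            by (rule order_trans[OF add_mono[OF large mult_le_mono2[OF dw, of 2]] total])
          then show False
            using 4 capacity_exceptional(2,3)[of k]
            by (auto simp: m_def power2_eq_square algebra_simps
            simp del: One_nat_def add_2_eq_Suc add_2_eq_Suc')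
        next
          case True
          have "\<exists>x \<in> A \<union> B. deg E x \<noteq> k + 1 + j"
          proof (rule ccontr)
            assume "\<not> ?thesis"
            then have low: "\<And>x. x \<in> A \<union> B \<Longrightarrow> deg E x = k + 1 + j" by blast
            have fin: "finite A" "finite B" "finite F" using finV finC V(1) F finite_subset by auto
            have "(\<Sum>v \<in> V. deg E v) = (\<Sum>v \<in> A \<union> B. deg E v) + (\<Sum>v \<in> C. deg E v)"
              unfolding V(1) using fin finC V by (intro sum.union_disjoint) auto
            also have "(\<Sum>v \<in> A \<union> B. deg E v) = card (A \<union> B) * (k + 1 + j)"
              using low by simp
            also have "card (A \<union> B) = j + 3"
              using fin V(2) card 4(2) by (simp add: card_Un_disjoint)
            also have "(\<Sum>v \<in> C. deg E v) = (\<Sum>v \<in> C - F. deg E v) + (\<Sum>v \<in> F. deg E v)"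
              using F finC by (rule sum.subset_diff)
            also have "(\<Sum>v \<in> F. deg E v) = card F * (m + 1)" by (simp add: F_def)
            also have "(\<Sum>v \<in> C - F. deg E v) = m" by (simp add: w True)
            also have "card F = k + j" using cF one by simp
            finally have "even ((j + 3) * (k + 1 + j) + (m + (k + j) * (m + 1)))"
              using even_sum_deg[OF E] by simp
            \<comment> \<open>the number is odd for \<open>j = 1\<close> and for \<open>j = 2\<close>, whatever the parity of \<open>k\<close>\<close>
            then show False using 4 by (auto simp: m_def)
          qed
          then obtain x where x: "x \<in> A \<union> B" "deg E x \<noteq> k + 1 + j" by blast
          have "deg E x \<le> k + 1 + j" using x(1) dA dB 4(2) by auto
          then have "deg E x \<le> k + j" using x(2) by simp
          then have "3 * (k + j)\<^sup>2 + 3 * (k + j) + 1 \<le> (k + j + 1) ^ 3 - deg E x ^ 3"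
            by (rule cube_drop)
          also have "\<dots> = loss x"
            using x(1) 4(2) by (auto simp: loss_def add.commute add.left_commute)
          finally have lx: "3 * (k + j)\<^sup>2 + 3 * (k + j) + 1 \<le> loss x" .
          have lw: "cost \<le> loss w"
            using cube_drop[of "deg E w" m] True loss_C[OF wV(2)] by (simp add: cost_def)
          have "x \<noteq> w" "x \<in> V" using x(1) wV(2) V by auto
          then have "loss x + loss w \<le> (\<Sum>v \<in> V. loss v)" using pair_loss wV(1) by blast
          note dxw = order_trans[OF add_mono[OF lx lw] this]
          have "capacity k 0 (2 * j + s) + card F * ((j + 2) * (2 + j + s)\<^sup>2) +
              2 * (3 * (k + j)\<^sup>2 + 3 * (k + j) + 1 + cost) \<le> capacity k j s"
            by (rule order_trans[OF add_mono[OF add_mono[OF large order_refl]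
                  mult_le_mono2[OF dxw, of 2]] budget])
          moreover have "card F = k + j" using cF one by simp
          ultimately show False
            using 4 capacity_exceptional(2,3)[of k]
            by (auto simp: cost_def m_def power2_eq_square algebra_simps
            simp del: One_nat_def add_2_eq_Suc add_2_eq_Suc')
        qed
      qed
    qed
    then have "C - F = {}" using CF(2) by simp
    then have "\<forall>v \<in> C. deg E v = m + 1" by (auto simp: F_def)
    then show ?thesis using 4 n by (simp add: m_def)
  qed
qed

text \<open>
  A vertex of \<open>L\<close> is adjacent to all of \<open>C\<close>, which already uses up its degree.
\<close>

lemma full_hubs_structure:
  assumes E: "simple_on (C \<union> L) E" and CL: "C \<inter> L = {}"
    and full: "\<And>v. v \<in> C \<Longrightarrow> deg E v + 1 = card (C \<union> L)"
    and low: "\<And>v. v \<in> L \<Longrightarrow> deg E v \<le> card C"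
    and xy: "x \<in> C \<union> L" "y \<in> C \<union> L"
  shows "{x, y} \<in> E \<longleftrightarrow> x \<noteq> y \<and> (x \<in> C \<or> y \<in> C)"
proof
  assume e: "{x, y} \<in> E"
  have fin: "finite (C \<union> L)" using E by (simp add: simple_on_def)
  have "x \<in> C \<or> y \<in> C"
  proof (rule ccontr)
    assume "\<not> (x \<in> C \<or> y \<in> C)"
    then have L: "x \<in> L" "y \<in> L" "y \<notin> C" using xy by auto
    have "insert y C \<subseteq> {w \<in> C \<union> L. {x, w} \<in> E}"
    proof
      fix w assume w: "w \<in> insert y C"
      show "w \<in> {w \<in> C \<union> L. {x, w} \<in> E}"
      proof (cases "w = y")
        case True
        then show ?thesis using e xy by simp
      next
        case False
        then have wC: "w \<in> C" using w by simp
        then have "{w, x} \<in> E"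
          using full[OF wC] xy(1) L(1) CL by (intro full_degree_adjacent[OF E]) auto
        then show ?thesis using wC by (simp add: insert_commute)
      qed
    qed
    then have "card (insert y C) \<le> deg E x"
      unfolding deg_eq_card_neighbours[OF E] using fin by (intro card_mono) auto
    then show False using low[OF L(1)] L(3) fin by simp
  qed
  then show "x \<noteq> y \<and> (x \<in> C \<or> y \<in> C)" using simple_onD(3)[OF E e] by simp
next
  assume a: "x \<noteq> y \<and> (x \<in> C \<or> y \<in> C)"
  then consider "x \<in> C" | "y \<in> C" by blast
  then show "{x, y} \<in> E"
  proof cases
    case 1
    then show ?thesis using full_degree_adjacent[OF E xy] a full by blast
  next
    case 2
    then have "{y, x} \<in> E" using full_degree_adjacent[OF E xy(2,1)] a full by blast
    then show ?thesis by (simp add: insert_commute)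
  qed
qed

theorem theorem3p3:
  fixes G :: "'a ugraph" and n k :: nat
  assumes "2 \<le> k" and "k + 5 \<le> n"
    and "simple_graph G" and "connected_graph G" and "graph_order G = n"
    and "k + 1 \<le> min_degree G"
    and "int (hyper_zagreb G) \<ge>
           2 * int n ^ 4 - 22 * int n ^ 3 + (12 * int k + 102) * int n ^ 2
           - (48 * int k + 210) * int n
           + 4 * int k ^ 3 + 12 * int k ^ 2 + 64 * int k + 164"
  shows "k_leaf_connected k G \<or>
         graph_isomorphic G (graph_join (complete_graph 5) (copies 5 (complete_graph 1))) \<or>
         graph_isomorphic G (graph_join (complete_graph 4) (copies 4 (complete_graph 1)))"
proof (cases "leaf_connected_on k (verts G) (edges G)")
  case True
  then show ?thesis using k_leaf_connected_if_leaf_connected_on assms(1,2,5) by fastforce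
next
  case False
  let ?V = "verts G" and ?E = "edges G"
  have E: "simple_on ?V ?E" using assms(3) by (simp add: simple_graph_def simple_on_def)
  have cV: "card ?V = n" using assms(5) by (simp add: graph_order_def)
  have deg: "graph_degree G = deg ?E" by (simp add: graph_degree_def deg_def fun_eq_iff)
  have finV: "finite ?V" using E by (simp add: simple_on_def)
  have min: "k + 1 \<le> deg ?E v" if "v \<in> ?V" for v
  proof -
    have "min_degree G \<le> deg ?E v"
      unfolding min_degree_def deg using finV that by (intro Min_le) auto
    then show ?thesis using assms(6) by linarith
  qed
  have "k + 1 \<le> card ?V" using assms(2) cV by simp
  from chvatal_partition[OF E False assms(1) this min]
  obtain A B C j s where V: "?V = A \<union> B \<union> C" "A \<inter> B = {}" "A \<inter> C = {}" "B \<inter> C = {}"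
    and n: "card ?V = k + 4 + 2 * j + s"
    and card: "card A = j + 2" "card B = s + 1" "card C = k + 1 + j"
    and dA: "\<And>v. v \<in> A \<Longrightarrow> deg ?E v \<le> k + 1 + j"
    and dB: "\<And>v. v \<in> B \<Longrightarrow> deg ?E v \<le> k + 1 + j + s"
    by metis
  have "hyper_zagreb G = hyper_zagreb_edges ?E" by (simp add: hyper_zagreb_def hyper_zagreb_edges_def deg)
  then have "int (capacity k 0 (2 * j + s)) \<le> int (hyper_zagreb_edges ?E)"
    using assms(7) capacity_threshold[of n k "2 * j + s"] n cV by simp
  then have large: "capacity k 0 (2 * j + s) \<le> hyper_zagreb_edges ?E" by simp
  note tight = only_split_graphs[OF E assms(1) V n card dA dB large]
  define L where "L = A \<union> B"
  have CL: "?V = C \<union> L" "C \<inter> L = {}" using V by (auto simp: L_def)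
  have fin: "finite C" "finite L" using finV CL(1) by auto
  have cL: "card L = j + 3"
    using card tight V(2) fin(2) by (simp add: L_def card_Un_disjoint)
  have struct: "{x, y} \<in> ?E \<longleftrightarrow> x \<noteq> y \<and> (x \<in> C \<or> y \<in> C)"
    if "x \<in> C \<union> L" "y \<in> C \<union> L" for x y
  proof (rule full_hubs_structure[OF _ CL(2) _ _ that])
    show "simple_on (C \<union> L) ?E" using E CL(1) by simp
    show "deg ?E v + 1 = card (C \<union> L)" if "v \<in> C" for v using tight that CL(1) by simp
    show "deg ?E v \<le> card C" if "v \<in> L" for v
      using that tight dA dB card(3) by (auto simp: L_def)
  qed
  have "k = 2"
  proof (rule ccontr)
    assume "k \<noteq> 2"
    then have "leaf_connected_on k (C \<union> L) ?E"
      using struct tight card(3) cL assms(1) fin CL(2)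
      by (intro leaf_connected_on_split_graph[where p = "j + 1"]) auto
    then show False using False CL(1) by simp
  qed
  then have cC: "card C = card L" "card L = 4 \<or> card L = 5"
    using card(3) cL tight by auto
  have "graph_isomorphic G (graph_join (complete_graph (card C)) (copies (card L) (complete_graph 1)))"
    by (rule split_graph_isomorphic[OF CL fin struct])
  then show ?thesis using cC by auto
qed

end
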